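(* Let $d\ge 1$, $k\ge 1$ and $Q\in D^{(k)}([0,1]^d)$. For $\bar s(k+1)\in\mathcal S^{k+1}(d)$ with $s_{k+1}\neq\emptyset$ put $\tilde Q^{(k)}_{\bar s(k+1)}(u(s_{k+1}))=\int_{(0(s_{k+1}),u(s_{k+1})]}Q^{(k)}_{\bar s(k+1)}(dy(s_{k+1}))$. Then for all $x\in[0,1]^d$, writing $m=m(\bar s(k+1))$ in each term of the first sum, $$Q(x)=\sum_{\bar s(k+1):\,s_{k+1}=\emptyset}\bar\phi_{\bar s(k+1)}(x)\,Q^{(m)}_{\bar s(m)}(0(s_m))+\sum_{\bar s(k+1):\,s_{k+1}\ne\emptyset}\bar\phi_{\bar s(k+1)}(x)\int_{(0(s_{k+1}),x(s_{k+1})]}\phi^k_{u}(x(s_{k+1}))\,Q^{(k)}_{\bar s(k+1)}(du),$$ where the integral over $(0(s_{k+1}),x(s_{k+1})]$ may equivalently be taken over $(0(s_{k+1}),1(s_{k+1})]$. Equivalently, $$Q(x)=\sum_{\bar s(k+1):\,s_{k+1}=\emptyset}\bar\phi_{\bar s(k+1)}(x)\,Q^{(m)}_{\bar s(m)}(0(s_m))+\sum_{\bar s(k+1):\,s_{k+1}\ne\emptyset}\bar\phi_{\bar s(k+1)}(x)\,\mu^k\big(\tilde Q^{(k)}_{\bar s(k+1)}\big)(x(s_{k+1})).$$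
   Context: Notation. For $s\subset\{1,\dots,d\}$: $x(s)=(x(j))_{j\in s}$, $-s$ is the complement of $s$, $(x(s),0(-s))$ is the vector with coordinates $x(j)$ for $j\in s$ and $0$ otherwise, $s/s'$ is set difference, and $\mu_s$ is Lebesgue measure on $(0(s),1(s)]$. A cadlag function $G$ of $x(s)$ of bounded variation generates a finite signed measure $G(du(s))$ on $(0(s),1(s)]$ through generalized differences over cubes; $\|G\|_v=\int_{(0(s),1(s)]}|G(du)|$, and $dG/d\mu_s$ is the Radon–Nikodym derivative of this measure with respect to $\mu_s$. Nested sequences. $\mathcal S^{k+1}(d)$ is the set of $\bar s(k+1)=(s_1,\dots,s_{k+1})$ with $s_{k+1}\subset\cdots\subset s_1\subset\{1,\dots,d\}$, empty sets allowed; $\bar s(j)=(s_1,\dots,s_j)$. If $s_{k+1}=\emptyset$, $m(\bar s(k+1))$ is the smallest $m\in\{0,\dots,k\}$ with $s_{m+1}=\emptyset$. When $s_1=\emptyset$ (so $m=0$), $Q^{(m)}_{\bar s(m)}(0(s_m))$ means $Q(0)$. Sequential derivatives of $Q:[0,1]^d\to\mathbb R$. Put $Q^{(0)}_{s_1}(x(s_1))=Q(x(s_1),0(-s_1))$; for $s_1\ne\emptyset$, $Q^{(1)}_{s_1}=dQ^{(0)}_{s_1}/d\mu_{s_1}$. Recursively for $j=1,\dots,k$, given $Q^{(j)}_{\bar s(j)}$ (a function of $x(s_j)\in[0(s_j),1(s_j)]$, $s_j\neq\emptyset$) and $s_{j+1}\subset s_j$, define the section $Q^{(j)}_{\bar s(j+1)}(x(s_{j+1}))=Q^{(j)}_{\bar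 s(j)}(x(s_{j+1}),0(s_j/s_{j+1}))$, which for $s_{j+1}=\emptyset$ is the constant $Q^{(j)}_{\bar s(j)}(0(s_j))$; and if $j<k$ and $s_{j+1}\neq\emptyset$ set $Q^{(j+1)}_{\bar s(j+1)}=dQ^{(j)}_{\bar s(j+1)}/d\mu_{s_{j+1}}$. If $s_{k+1}=\emptyset$, $Q^{(k)}_{\bar s(k+1)}$ is the constant $Q^{(m)}_{\bar s(m)}(0(s_m))$ with $m=m(\bar s(k+1))$, whose variation norm is its absolute value. Smoothness class. $D^{(k)}([0,1]^d)$ is the set of $Q:[0,1]^d\to\mathbb R$ for which all these derivatives exist (in particular the required absolute continuity holds at each step) and every $Q^{(k)}_{\bar s(k+1)}$, $\bar s(k+1)\in\mathcal S^{k+1}(d)$, is real-valued cadlag with finite variation norm. Splines. For $u,x\in[0,1]^s$: $\phi^0_u(x)=I(u\le x)$ and $\phi^j_u(x)=\int_{(u,x]}\phi^{j-1}_{u_1}(x)\,d\mu_s(u_1)$, i.e. $\phi^j_u(x)=\prod_{l\in s}\frac{(x(l)-u(l))^j}{j!}I(x(l)\ge u(l))$ (equal to $1$ if $s=\emptyset$). Define $\bar\phi_{\bar s(k+1)}(x)=\prod_{j=1}^{k}\phi^j_0(x(s_j/s_{j+1}))$ if $s_{k+1}\neq\emptyset$, and $\bar\phi_{\bar s(k+1)}(x)=\prod_{j=1}^{m(\bar s(k+1))}\phi_0^j(x(s_j/s_{j+1}))$ if $s_{k+1}=\emptyset$ (empty product $=1$). Primitives. For a function $G$ of $x(s)$,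 $\mu^1(G)(x(s))=\int_{(0(s),x(s)]}G\,d\mu_s$ and $\mu^j(G)(x(s))=\int_{(0(s),x(s)]}\mu^{j-1}(G)\,d\mu_s$ for $j\ge2$. *)

theory Defs
  imports "HOL-Analysis.Analysis"
begin

text \<open>
  A point \<open>x(s)\<close> is an extensional function on the finite index set \<open>s\<close>
  (\<open>undefined\<close> outside \<open>s\<close>), as in the product measure \<open>Pi\<^sub>M s M\<close>. For \<open>s = {}\<close> there is
  exactly one point, every box is that one-point set, and \<open>mu {}\<close> has total mass 1.
\<close>

definition unit_cube :: "nat set \<Rightarrow> (nat \<Rightarrow> real) set" where
  "unit_cube s = PiE s (\<lambda>_. {0..1})"

definition box_oc :: "nat set \<Rightarrow> (nat \<Rightarrow> real) \<Rightarrow> (nat \<Rightarrow> real) \<Rightarrow> (nat \<Rightarrow> real) set" where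
  "box_oc s a b = PiE s (\<lambda>j. {a j<..b j})"

definition mu :: "nat set \<Rightarrow> (nat \<Rightarrow> real) measure" where
  "mu s = restrict_space (Pi\<^sub>M s (\<lambda>_. lborel)) (box_oc s (\<lambda>_. 0) (\<lambda>_. 1))"


text \<open>
  Multivariate cadlag functions: at every point, the limit from each of the
  \<open>2 ^ card s\<close> quadrants (strictly below in the coordinates of \<open>t\<close>, at or above in the others)
  exists, and the function is continuous from the upper right quadrant. Quadrants that do not meet
  the cube give the trivial filter and impose nothing.
\<close>

definition quadrant :: "nat set \<Rightarrow> nat set \<Rightarrow> (nat \<Rightarrow> real) \<Rightarrow> (nat \<Rightarrow> real) set" where
  "quadrant s t x = {y \<in> unit_cube s. \<forall>j\<in>s. if j \<in> t then y j < x j else x j \<le> y j}"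

definition cadlag :: "nat set \<Rightarrow> ((nat \<Rightarrow> real) \<Rightarrow> real) \<Rightarrow> bool" where
  "cadlag s G \<longleftrightarrow> (\<forall>x\<in>unit_cube s.
     (G \<longlongrightarrow> G x) (at x within quadrant s {} x) \<and>
     (\<forall>t\<subseteq>s. \<exists>l. (G \<longlongrightarrow> l) (at x within quadrant s t x)))"


text \<open>
  Finite signed measures are real-valued countably additive set functions; they are set to 0 on
  non-measurable sets so that they are determined by their values on \<open>sets M\<close>.
\<close>

definition signed_measure :: "'a measure \<Rightarrow> ('a set \<Rightarrow> real) \<Rightarrow> bool" where
  "signed_measure M \<nu> \<longleftrightarrow> \<nu> {} = 0 \<and>
     (\<forall>A :: nat \<Rightarrow> 'a set. range A \<subseteq> sets M \<longrightarrow> disjoint_family A \<longrightarrow>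
        (\<lambda>i. \<nu> (A i)) sums \<nu> (\<Union>i. A i)) \<and>
     (\<forall>A. A \<notin> sets M \<longrightarrow> \<nu> A = 0)"

text \<open>Jordan decomposition: \<open>\<nu>\<^sup>+(A)\<close> is the supremum of \<open>\<nu> B\<close> over measurable \<open>B \<subseteq> A\<close>.\<close>

definition pos_variation :: "'a measure \<Rightarrow> ('a set \<Rightarrow> real) \<Rightarrow> 'a measure" where
  "pos_variation M \<nu> =
     measure_of (space M) (sets M) (\<lambda>A. SUP B\<in>{B \<in> sets M. B \<subseteq> A}. ennreal (\<nu> B))"

definition neg_variation :: "'a measure \<Rightarrow> ('a set \<Rightarrow> real) \<Rightarrow> 'a measure" where
  "neg_variation M \<nu> = pos_variation M (\<lambda>A. - \<nu> A)"

definition total_variation :: "'a measure \<Rightarrow> ('a set \<Rightarrow> real) \<Rightarrow> ennreal" where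
  "total_variation M \<nu> =
     emeasure (pos_variation M \<nu>) (space M) + emeasure (neg_variation M \<nu>) (space M)"

definition signed_integral ::
  "'a measure \<Rightarrow> ('a set \<Rightarrow> real) \<Rightarrow> 'a set \<Rightarrow> ('a \<Rightarrow> real) \<Rightarrow> real" where
  "signed_integral M \<nu> A f =
     (LINT u:A|pos_variation M \<nu>. f u) - (LINT u:A|neg_variation M \<nu>. f u)"


definition gen_diff ::
  "nat set \<Rightarrow> ((nat \<Rightarrow> real) \<Rightarrow> real) \<Rightarrow> (nat \<Rightarrow> real) \<Rightarrow> (nat \<Rightarrow> real) \<Rightarrow> real" where
  "gen_diff s G a b =
     (\<Sum>t\<in>Pow s. (-1) ^ card (s - t) * G (\<lambda>j\<in>s. if j \<in> t then b j else a j))"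

definition generates ::
  "nat set \<Rightarrow> ((nat \<Rightarrow> real) \<Rightarrow> real) \<Rightarrow> ((nat \<Rightarrow> real) set \<Rightarrow> real) \<Rightarrow> bool" where
  "generates s G \<nu> \<longleftrightarrow> signed_measure (mu s) \<nu> \<and>
     (\<forall>a\<in>unit_cube s. \<forall>b\<in>unit_cube s. (\<forall>j\<in>s. a j \<le> b j) \<longrightarrow>
        \<nu> (box_oc s a b) = gen_diff s G a b)"

text \<open>The measure \<open>G(du)\<close>; it is unique since the boxes generate \<open>sets (mu s)\<close>.\<close>

definition gen_measure ::
  "nat set \<Rightarrow> ((nat \<Rightarrow> real) \<Rightarrow> real) \<Rightarrow> (nat \<Rightarrow> real) set \<Rightarrow> real" where
  "gen_measure s G = (THE \<nu>. generates s G \<nu>)"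

text \<open>
  The total mass of \<open>|G(du)|\<close>, and infinity if the generalized differences do not extend to a
  finite signed measure. For \<open>s = {}\<close> this is the absolute value of the constant \<open>G\<close>.
\<close>

definition variation_norm :: "nat set \<Rightarrow> ((nat \<Rightarrow> real) \<Rightarrow> real) \<Rightarrow> ennreal" where
  "variation_norm s G =
     (if \<exists>\<nu>. generates s G \<nu> then total_variation (mu s) (gen_measure s G) else \<infinity>)"

text \<open>
  \<open>g\<close> is a version of \<open>dG/d\<mu>\<^sub>s\<close>. Absolute continuity of \<open>G(du)\<close> with respect to
  \<open>\<mu>\<^sub>s\<close> is contained in the existence of the density.
\<close>

definition is_RN_derivative ::
  "nat set \<Rightarrow> ((nat \<Rightarrow> real) \<Rightarrow> real) \<Rightarrow> ((nat \<Rightarrow> real) \<Rightarrow> real) \<Rightarrow> bool" where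
  "is_RN_derivative s G g \<longleftrightarrow>
     cadlag s G \<and> variation_norm s G < \<infinity> \<and> integrable (mu s) g \<and>
     (\<forall>A\<in>sets (mu s). gen_measure s G A = (LINT u:A|mu s. g u))"


text \<open>
  A nested sequence \<open>(s\<^sub>1, \<dots>, s\<^sub>n)\<close> is a list, with \<open>s\<^sub>j\<close> at position \<open>j - 1\<close>. By convention
  \<open>s\<^sub>0 = {1..d}\<close>, so that \<open>last ({1..d} # take j ss)\<close> is \<open>s\<^sub>j\<close> for every \<open>j \<le> n\<close>.
\<close>

definition nested_seqs :: "nat \<Rightarrow> nat \<Rightarrow> nat set list set" where
  "nested_seqs n d = {ss. length ss = n \<and> set ss \<subseteq> Pow {1..d} \<and> sorted_wrt (\<supseteq>) ss}"

definition first_empty :: "nat set list \<Rightarrow> nat" where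
  "first_empty ss = (LEAST m. m < length ss \<and> ss ! m = {})"

text \<open>
  For a family \<open>q\<close> with \<open>q [s\<^sub>1, \<dots>, s\<^sub>j]\<close> in the role of \<open>Q\<^sup>(\<^sup>j\<^sup>)\<close>, the section for
  \<open>ss = [s\<^sub>1, \<dots>, s\<^sub>j, t]\<close> is \<open>y(t) \<mapsto> Q\<^sup>(\<^sup>j\<^sup>)(y(t), 0(s\<^sub>j - t))\<close>.
\<close>

definition deriv_section ::
  "nat \<Rightarrow> (nat set list \<Rightarrow> (nat \<Rightarrow> real) \<Rightarrow> real) \<Rightarrow> nat set list \<Rightarrow> (nat \<Rightarrow> real) \<Rightarrow> real" where
  "deriv_section d q ss y =
     q (butlast ss) (\<lambda>j\<in>last ({1..d} # butlast ss). if j \<in> last ss then y j else 0)"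

text \<open>The constant \<open>Q\<^sup>(\<^sup>m\<^sup>)(0(s\<^sub>m))\<close> with \<open>m = first_empty ss\<close>; this is \<open>Q(0)\<close> if \<open>m = 0\<close>.\<close>

definition deriv_at_zero ::
  "nat \<Rightarrow> (nat set list \<Rightarrow> (nat \<Rightarrow> real) \<Rightarrow> real) \<Rightarrow> nat set list \<Rightarrow> real" where
  "deriv_at_zero d q ss =
     (let m = first_empty ss in q (take m ss) (\<lambda>j\<in>last ({1..d} # take m ss). 0))"

definition top_deriv ::
  "nat \<Rightarrow> (nat set list \<Rightarrow> (nat \<Rightarrow> real) \<Rightarrow> real) \<Rightarrow> nat set list \<Rightarrow> (nat \<Rightarrow> real) \<Rightarrow> real" where
  "top_deriv d q ss =
     (if last ss = {} then (\<lambda>_. deriv_at_zero d q ss) else deriv_section d q ss)"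

text \<open>
  Radon--Nikodym derivatives are determined only almost everywhere, whereas sections evaluate them
  on null sets. A family \<open>q\<close> therefore carries the chosen versions, and these have to make all the
  sections regular. The values of \<open>q\<close> on other lists are irrelevant.
\<close>

definition sequential_derivatives ::
  "nat \<Rightarrow> nat \<Rightarrow> ((nat \<Rightarrow> real) \<Rightarrow> real) \<Rightarrow> (nat set list \<Rightarrow> (nat \<Rightarrow> real) \<Rightarrow> real) \<Rightarrow> bool" where
  "sequential_derivatives k d Q q \<longleftrightarrow> q [] = Q \<and>
     (\<forall>j<k. \<forall>ss\<in>nested_seqs (Suc j) d. last ss \<noteq> {} \<longrightarrow>
        is_RN_derivative (last ss) (deriv_section d q ss) (q ss))"

definition smooth_derivatives ::
  "nat \<Rightarrow> nat \<Rightarrow> ((nat \<Rightarrow> real) \<Rightarrow> real) \<Rightarrow> (nat set list \<Rightarrow> (nat \<Rightarrow> real) \<Rightarrow> real) \<Rightarrow> bool" where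
  "smooth_derivatives k d Q q \<longleftrightarrow> sequential_derivatives k d Q q \<and>
     (\<forall>ss\<in>nested_seqs (Suc k) d. cadlag (last ss) (top_deriv d q ss) \<and>
        variation_norm (last ss) (top_deriv d q ss) < \<infinity>)"

definition smooth_class :: "nat \<Rightarrow> nat \<Rightarrow> ((nat \<Rightarrow> real) \<Rightarrow> real) set" where
  "smooth_class k d = {Q. \<exists>q. smooth_derivatives k d Q q}"


primrec spline :: "nat \<Rightarrow> nat set \<Rightarrow> (nat \<Rightarrow> real) \<Rightarrow> (nat \<Rightarrow> real) \<Rightarrow> real" where
  "spline 0 s u x = (if \<forall>l\<in>s. u l \<le> x l then 1 else 0)"
| "spline (Suc j) s u x = (LINT v:box_oc s u x|mu s. spline j s v x)"

lemma integral_Ioc_power: fixes u x :: real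
  shows "(LINT v|lborel. indicator {u<..x} v * ((x - v)^j / fact j)) = (if u \<le> x then (x-u)^Suc j / fact (Suc j) else 0)"
    and "integrable lborel (\<lambda>v. indicator {u<..x} v * ((x - v)^j / fact j))"
proof -
  let ?f = "\<lambda>v::real. (x - v)^j / fact j"
  let ?F = "\<lambda>v::real. - ((x - v)^Suc j / fact (Suc j))"
  have ae: "AE v in lborel. indicator {u<..x} v * ?f v = indicator {u..x} v * ?f v"
    by (rule AE_mp[OF AE_lborel_singleton[of u]]) (auto simp: indicator_def)
  have hb: "has_bochner_integral lborel (\<lambda>v. indicator {u<..x} v * ?f v) (if u \<le> x then (x-u)^Suc j / fact (Suc j) else 0)"
  proof (cases "u \<le> x")
    case True
    have "has_bochner_integral lborel (\<lambda>v. indicator {u..x} v *\<^sub>R ?f v) (?F x - ?F u)"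
    proof (rule has_bochner_integral_FTC_Icc[OF True])
      show "(?F has_vector_derivative ?f v) (at v within {u..x})" for v
        unfolding has_real_derivative_iff_has_vector_derivative[symmetric]
        by (rule derivative_eq_intros refl | simp)+
      show "continuous_on {u..x} ?f" by (intro continuous_intros) auto
    qed
    then have "has_bochner_integral lborel (\<lambda>v. indicator {u..x} v * ?f v) ((x-u)^Suc j / fact (Suc j))"
      by simp
    also have "has_bochner_integral lborel (\<lambda>v. indicator {u..x} v * ?f v) ((x-u)^Suc j / fact (Suc j)) \<longleftrightarrow>
       has_bochner_integral lborel (\<lambda>v. indicator {u<..x} v * ?f v) ((x-u)^Suc j / fact (Suc j))"
      by (rule has_bochner_integral_cong_AE) (use ae in \<open>auto elim: AE_mp\<close>)
    finally show ?thesis using True by simp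
  next
    case False then show ?thesis by (simp add: has_bochner_integral_zero)
  qed
  show "(LINT v|lborel. indicator {u<..x} v * ((x - v)^j / fact j)) = (if u \<le> x then (x-u)^Suc j / fact (Suc j) else 0)"
    using hb by (rule has_bochner_integral_integral_eq)
  show "integrable lborel (\<lambda>v. indicator {u<..x} v * ((x - v)^j / fact j))"
    using hb by (rule integrable.intros)
qed

lemma spline_closed_form:
  assumes "finite s" "\<forall>l\<in>s. 0 \<le> u l" "\<forall>l\<in>s. x l \<le> 1"
  shows "spline j s u x = (\<Prod>l\<in>s. if u l \<le> x l then (x l - u l) ^ j / fact j else 0)"
  using assms(2)
proof (induction j arbitrary: u)
  case 0
  have "(\<Prod>l\<in>s. if u l \<le> x l then (x l - u l) ^ 0 / fact 0 else 0::real) = (if \<forall>l\<in>s. u l \<le> x l then 1 else 0)"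
    using assms(1) by (induction s) auto
  then show ?case unfolding spline.simps by (rule sym)
next
  case (Suc j)
  interpret product_sigma_finite "\<lambda>_::nat. lborel :: real measure" by standard
  let ?P = "Pi\<^sub>M s (\<lambda>_. lborel :: real measure)"
  have box: "box_oc s a b \<in> sets ?P" for a b
    unfolding box_oc_def using assms(1) by (auto intro!: sets_PiM_I_finite)
  have "spline (Suc j) s u x = (LINT v|?P. indicator (box_oc s (\<lambda>_. 0) (\<lambda>_. 1)) v *\<^sub>R (indicator (box_oc s u x) v *\<^sub>R spline j s v x))"
    unfolding spline.simps set_lebesgue_integral_def mu_def
    by (subst integral_restrict_space) (use box in \<open>auto simp: sets.Int_space_eq2 set_lebesgue_integral_def\<close>)
  also have "\<dots> = (LINT v|?P. (\<Prod>l\<in>s. indicator {u l<..x l} (v l) * ((x l - v l)^j / fact j)))"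
  proof (rule Bochner_Integration.integral_cong[OF refl])
    fix v assume v: "v \<in> space ?P"
    show "indicator (box_oc s (\<lambda>_. 0) (\<lambda>_. 1)) v *\<^sub>R (indicator (box_oc s u x) v *\<^sub>R spline j s v x) =
      (\<Prod>l\<in>s. indicator {u l<..x l} (v l) * ((x l - v l)^j / fact j))"
    proof (cases "v \<in> box_oc s u x")
      case True
      then have b: "\<forall>l\<in>s. u l < v l \<and> v l \<le> x l" by (auto simp: box_oc_def PiE_iff)
      then have "v \<in> box_oc s (\<lambda>_. 0) (\<lambda>_. 1)" using True Suc.prems assms(3)
        by (fastforce simp: box_oc_def PiE_iff)
      moreover have "\<forall>l\<in>s. 0 \<le> v l" using b Suc.prems by force
      ultimately show ?thesis using True b Suc.IH[of v]
        by (auto intro!: prod.cong)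
    next
      case False
      then obtain l where "l \<in> s" "\<not> (u l < v l \<and> v l \<le> x l)" using v
        by (auto simp: box_oc_def PiE_iff space_PiM)
      then have "(\<Prod>l\<in>s. indicator {u l<..x l} (v l) * ((x l - v l)^j / fact j)) = 0"
        using assms(1) by (intro prod_zero) (auto intro!: bexI[of _ l] simp: indicator_def)
      then show ?thesis using False by simp
    qed
  qed
  also have "\<dots> = (\<Prod>l\<in>s. (LINT v|lborel. indicator {u l<..x l} v * ((x l - v)^j / fact j)))"
    by (rule product_integral_prod[OF assms(1)]) (rule integral_Ioc_power)
  also have "\<dots> = (\<Prod>l\<in>s. if u l \<le> x l then (x l - u l) ^ Suc j / fact (Suc j) else 0)"
    by (rule prod.cong[OF refl]) (rule integral_Ioc_power)
  finally show ?case .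
qed

definition bar_spline :: "nat set list \<Rightarrow> (nat \<Rightarrow> real) \<Rightarrow> real" where
  "bar_spline ss x =
     (if last ss \<noteq> {}
      then \<Prod>j=1..length ss - 1. spline j (ss ! (j - 1) - ss ! j) (\<lambda>_. 0) x
      else \<Prod>j=1..first_empty ss. spline j (ss ! (j - 1) - ss ! j) (\<lambda>_. 0) x)"

primrec primitive ::
  "nat \<Rightarrow> nat set \<Rightarrow> ((nat \<Rightarrow> real) \<Rightarrow> real) \<Rightarrow> (nat \<Rightarrow> real) \<Rightarrow> real" where
  "primitive 0 s G x = G x"
| "primitive (Suc j) s G x = (LINT u:box_oc s (\<lambda>_. 0) x|mu s. primitive j s G u)"

definition top_cumulative ::
  "nat \<Rightarrow> (nat set list \<Rightarrow> (nat \<Rightarrow> real) \<Rightarrow> real) \<Rightarrow> nat set list \<Rightarrow> (nat \<Rightarrow> real) \<Rightarrow> real" where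
  "top_cumulative d q ss u =
     signed_integral (mu (last ss)) (gen_measure (last ss) (top_deriv d q ss))
       (box_oc (last ss) (\<lambda>_. 0) u) (\<lambda>_. 1)"

end

theory Submission
  imports Defs
begin

text \<open>
  By Moebius inversion over subsets, every function \<open>G\<close> on the unit cube satisfies
  \<open>G(x) = (\<Sum>t \<subseteq> s. \<nu>\<^sub>t(0, x(t)])\<close>, where \<open>\<nu>\<^sub>t\<close> is the measure generated by the section of \<open>G\<close>
  with the coordinates outside \<open>t\<close> set to 0. Apply this to \<open>G = Q\<^sup>(\<^sup>n\<^sup>)\<close> inside the \<open>n\<close>-fold primitive
  over \<open>(0, x(s\<^sub>n)]\<close>: the coordinates in \<open>s\<^sub>n - t\<close> factor out as a spline, the summand \<open>t = {}\<close> is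
  constant, and otherwise \<open>\<nu>\<^sub>t\<close> is the integral of the next derivative, which gives an \<open>n + 1\<close>-fold
  primitive. At level \<open>k\<close> Fubini's theorem, applied to the positive and negative variation, turns
  the \<open>k\<close>-fold primitive of \<open>\<nu>(0, u]\<close> into the integral of the spline of order \<open>k\<close> against \<open>\<nu>\<close>.
\<close>

section \<open>Lebesgue measure on the half-open cube\<close>

text \<open>Derivatives are fixed only almost everywhere, but proper sections live on null sets, so
  the expansion has to be pointwise. Moebius inversion is such a pointwise algebraic identity, and
  it also gives regularity: each nonconstant summand is a difference of distribution functions of
  two finite measures, so on the cube a chosen version \<open>q ss\<close> is a finite sum of
  bounded measurable functions, as Fubini and the linearity of primitives require. Three further
  points shape the development. \<open>gen_measure\<close> is a definite description, so nothing is
  known of it until uniqueness is proved. The variation measures are given by suprema over subsets,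
  so their additivity and the Jordan decomposition have to be derived. A branch that reaches the
  empty set early is prolonged by further empty sets without changing its term, so at every level
  all terms are indexed by lists of one length.\<close>

lemma mem_box_oc: "x \<in> box_oc s a b \<longleftrightarrow> x \<in> extensional s \<and> (\<forall>j\<in>s. a j < x j \<and> x j \<le> b j)"
  by (auto simp: box_oc_def PiE_iff)

lemma mem_unit_cube: "x \<in> unit_cube s \<longleftrightarrow> x \<in> extensional s \<and> (\<forall>j\<in>s. 0 \<le> x j \<and> x j \<le> 1)"
  by (auto simp: unit_cube_def PiE_iff)

lemma box_oc_restrict [simp]: "box_oc s (restrict a s) b = box_oc s a b"
  "box_oc s a (restrict b s) = box_oc s a b"
  by (auto simp: mem_box_oc)

lemma box_oc_subset_unit:
  assumes "b \<in> unit_cube s"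
  shows "box_oc s (\<lambda>_. 0) b \<subseteq> box_oc s (\<lambda>_. 0) (\<lambda>_. 1)"
  using assms by (fastforce simp: mem_box_oc mem_unit_cube)

section \<open>Product structure of the measure on the cube\<close>

definition unit_lborel :: "real measure" where
  "unit_lborel = restrict_space lborel {0<..1}"

lemma space_unit_lborel [simp]: "space unit_lborel = {0<..1}"
  by (simp add: unit_lborel_def space_restrict_space)

text \<open>These are the traces of the half-lines on (0,1]. Keeping b = 0, which gives the empty
  set, makes them exactly the factors of the boxes with lower corner 0.\<close>

lemma sets_unit_lborel: "sets unit_lborel = sets (sigma {0<..1} ((\<lambda>b. {0<..b}) ` {0..1}))"
proof -
  have "sets unit_lborel = (\<inter>) {0<..1} ` sigma_sets UNIV (range (\<lambda>a. {..a::real}))"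
    by (simp add: unit_lborel_def sets_restrict_space borel_eq_atMost sets_measure_of)
  also have "\<dots> = sigma_sets {0<..1} ((\<inter>) {0<..1} ` range (\<lambda>a. {..a::real}))"
  proof (rule sigma_sets_Int)
    have "{0<..1::real} \<in> sets borel" by simp
    then show "{0<..1::real} \<in> sigma_sets UNIV (range (\<lambda>a. {..a}))"
      by (simp add: borel_eq_atMost sets_measure_of)
  qed simp
  also have "(\<inter>) {0<..1} ` range (\<lambda>a. {..a::real}) = (\<lambda>b. {0<..b}) ` {0..1}"
  proof (intro equalityI subsetI)
    fix A assume "A \<in> (\<inter>) {0<..1} ` range (\<lambda>a. {..a::real})"
    then obtain a where "A = {0<..1} \<inter> {..a}" by auto
    \<comment> \<open>Clamping \<open>a\<close> to [0,1] leaves the trace on (0,1]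
      unchanged.\<close>
    then have "A = {0<..max 0 (min 1 a)}" by auto
    then show "A \<in> (\<lambda>b. {0<..b}) ` {0..1}" by auto
  next
    fix A assume "A \<in> (\<lambda>b. {0<..b}) ` {0..1::real}"
    then obtain b where "b \<in> {0..1}" "A = {0<..b}" by auto
    then have "A = {0<..1} \<inter> {..b}" by auto
    then show "A \<in> (\<inter>) {0<..1} ` range (\<lambda>a. {..a::real})" by auto
  qed
  finally show ?thesis by (subst sets_measure_of) auto
qed

lemma emeasure_unit_lborel: "emeasure unit_lborel {0<..1} = 1"
  by (simp add: unit_lborel_def emeasure_restrict_space)

interpretation unit_lborel: finite_measure unit_lborel
  by (rule finite_measureI) (simp add: emeasure_unit_lborel)

interpretation unit_product: product_sigma_finite "\<lambda>_::nat. unit_lborel"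
  by standard

interpretation lborel_product: product_sigma_finite "\<lambda>_::nat. lborel :: real measure" by standard

lemma measurable_id_unit_lborel: "(\<lambda>x. x) \<in> unit_lborel \<rightarrow>\<^sub>M borel"
  by (simp add: unit_lborel_def measurable_restrict_space1)

text \<open>Restriction to the cube commutes with the product because the cube is itself a
  rectangle. As a product of finite measures on (0,1], \<open>mu s\<close> becomes accessible to
  Fubini for products and to generator results for product sigma-algebras.\<close>

lemma mu_eq_PiM:
  assumes "finite s"
  shows "mu s = Pi\<^sub>M s (\<lambda>_. unit_lborel)"
proof (rule unit_product.PiM_eqI[OF assms])
  let ?P = "Pi\<^sub>M s (\<lambda>_. lborel :: real measure)" and ?\<Omega> = "box_oc s (\<lambda>_. 0) (\<lambda>_. 1)"
  have \<Omega>: "?\<Omega> \<in> sets ?P" using assms by (auto simp: box_oc_def intro!: sets_PiM_I_finite)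
  have "sets (mu s) \<subseteq> sets (Pi\<^sub>M s (\<lambda>_. unit_lborel))"
  proof -
    have "(\<lambda>x. x) \<in> Pi\<^sub>M s (\<lambda>_. unit_lborel) \<rightarrow>\<^sub>M ?P"
      by (rule measurable_PiM_single')
        (auto simp: space_PiM PiE_iff intro!: measurable_compose[OF measurable_component_singleton] simp: unit_lborel_def measurable_restrict_space1)
    then have "(\<lambda>x. x) \<in> Pi\<^sub>M s (\<lambda>_. unit_lborel) \<rightarrow>\<^sub>M mu s"
      unfolding mu_def by (rule measurable_restrict_space2[rotated])
        (auto simp: space_PiM box_oc_def)
    moreover have "space (mu s) = space (Pi\<^sub>M s (\<lambda>_. unit_lborel))"
      using \<Omega> by (auto simp: mu_def space_restrict_space box_oc_def space_PiM)
    ultimately show ?thesis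
    proof (intro subsetI)
      fix A assume id: "(\<lambda>x. x) \<in> Pi\<^sub>M s (\<lambda>_. unit_lborel) \<rightarrow>\<^sub>M mu s"
        and sp: "space (mu s) = space (Pi\<^sub>M s (\<lambda>_. unit_lborel))" and A: "A \<in> sets (mu s)"
      have "A \<subseteq> space (Pi\<^sub>M s (\<lambda>_. unit_lborel))"
        using sets.sets_into_space[OF A] sp by simp
      then show "A \<in> sets (Pi\<^sub>M s (\<lambda>_. unit_lborel))"
        using measurable_sets[OF id A] by (simp add: Int_absorb2)
    qed
  qed
  moreover have "sets (Pi\<^sub>M s (\<lambda>_. unit_lborel)) \<subseteq> sets (mu s)"
  proof (rule sets_PiM_in_sets)
    show sp: "space (mu s) = (\<Pi>\<^sub>E i\<in>s. space unit_lborel)"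
      using \<Omega> by (auto simp: mu_def space_restrict_space box_oc_def space_PiM)
    fix i A assume "i \<in> s" and "A \<in> sets unit_lborel"
    then have A: "A \<in> sets borel" "A \<subseteq> {0<..1}"
      by (auto simp: unit_lborel_def sets_restrict_space_iff)
    have "{x\<in>space ?P. x i \<in> A} \<in> sets ?P"
      using \<open>i \<in> s\<close> A by measurable
    moreover have "{x\<in>space (mu s). x i \<in> A} = ?\<Omega> \<inter> {x\<in>space ?P. x i \<in> A}"
      by (auto simp: sp box_oc_def space_PiM)
    ultimately show "{x\<in>space (mu s). x i \<in> A} \<in> sets (mu s)"
      unfolding mu_def by (simp add: sets_restrict_space)
  qed
  ultimately show "sets (mu s) = sets (Pi\<^sub>M s (\<lambda>_. unit_lborel))" by (rule equalityI)
  fix A assume "\<And>i. i \<in> s \<Longrightarrow> A i \<in> sets unit_lborel"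
  then have A: "A i \<in> sets borel" "A i \<subseteq> {0<..1}" if "i \<in> s" for i
    using that by (fastforce simp: unit_lborel_def sets_restrict_space_iff)+
  then have "emeasure (mu s) (Pi\<^sub>E s A) = emeasure ?P (Pi\<^sub>E s A)"
    unfolding mu_def by (subst emeasure_restrict_space) (use \<Omega> A in \<open>auto simp: box_oc_def PiE_mono\<close>)
  also have "\<dots> = (\<Prod>i\<in>s. emeasure lborel (A i))"
    by (rule lborel_product.emeasure_PiM) (use assms A in auto)
  also have "\<dots> = (\<Prod>i\<in>s. emeasure unit_lborel (A i))"
    by (rule prod.cong) (use A in \<open>auto simp: unit_lborel_def emeasure_restrict_space\<close>)
  finally show "emeasure (mu s) (Pi\<^sub>E s A) = (\<Prod>i\<in>s. emeasure unit_lborel (A i))" .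
qed

lemma space_mu: "finite s \<Longrightarrow> space (mu s) = box_oc s (\<lambda>_. 0) (\<lambda>_. 1)"
  by (simp add: mu_eq_PiM space_PiM box_oc_def)

lemma emeasure_mu_space: "finite s \<Longrightarrow> emeasure (mu s) (space (mu s)) = 1"
  by (simp add: mu_eq_PiM space_PiM unit_product.emeasure_PiM emeasure_unit_lborel sets.top[of unit_lborel, simplified])

lemma finite_measure_mu: "finite s \<Longrightarrow> finite_measure (mu s)"
  by (rule finite_measureI) (simp add: emeasure_mu_space)

lemma measurable_mu_component:
  assumes "f \<in> M \<rightarrow>\<^sub>M mu s" "finite s" "l \<in> s"
  shows "(\<lambda>w. f w l) \<in> borel_measurable M"
proof -
  have "(\<lambda>w. f w l) \<in> M \<rightarrow>\<^sub>M unit_lborel"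
    using assms(1,3) unfolding mu_eq_PiM[OF assms(2)]
    by (rule measurable_compose[OF _ measurable_component_singleton])
  then show ?thesis
    by (rule measurable_compose[OF _ measurable_id_unit_lborel])
qed

section \<open>Boxes anchored at the origin as a generating system\<close>

lemma box_oc_sets_mu:
  assumes "finite s" "b \<in> unit_cube s"
  shows "box_oc s (\<lambda>_. 0) b \<in> sets (mu s)"
proof -
  note [measurable] = measurable_mu_component[OF measurable_ident assms(1), unfolded id_def]
  have "{x \<in> space (mu s). \<forall>l\<in>s. x l \<le> b l} \<in> sets (mu s)" using assms(1) by measurable
  moreover have "{x \<in> space (mu s). \<forall>l\<in>s. x l \<le> b l} = box_oc s (\<lambda>_. 0) b"
    using box_oc_subset_unit[OF assms(2)] by (auto simp: space_mu[OF assms(1)] mem_box_oc)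
  ultimately show ?thesis by simp
qed

text \<open>In each coordinate the intervals (0,b] already generate, so boxes with lower corner 0
  suffice. They are closed under intersection, which makes them usable in a Dynkin argument.\<close>

lemma sets_mu_boxes:
  assumes "finite s"
  shows "sets (mu s) = sigma_sets (box_oc s (\<lambda>_. 0) (\<lambda>_. 1)) (box_oc s (\<lambda>_. 0) ` unit_cube s)"
proof -
  let ?E = "(\<lambda>b. {0<..b::real}) ` {0..1}"
  let ?P = "{{f \<in> (\<Pi>\<^sub>E i\<in>s. {0<..1}). \<forall>i\<in>j. f i \<in> A i} | A j. j \<in> {s} \<and> A \<in> Pi j (\<lambda>_. ?E)}"
  have "sets (mu s) = sets (Pi\<^sub>M s (\<lambda>_. sigma {0<..1} ?E))"
    unfolding mu_eq_PiM[OF assms] by (rule sets_PiM_cong) (simp_all add: sets_unit_lborel)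
  \<comment> \<open>The rule asks for a countable cover of each factor by generators; (0,1], the
    case b = 1, is one by itself. Covering the index set by the single block \<open>s\<close> makes
    every generator constrain all coordinates at once.\<close>
  also have "\<dots> = sets (sigma (\<Pi>\<^sub>E i\<in>s. {0<..1}) ?P)"
    by (rule sets_PiM_sigma) (use assms in \<open>auto intro!: exI[of _ "{{0<..1}}"]\<close>)
  also have "?P = box_oc s (\<lambda>_. 0) ` unit_cube s"
  proof (intro equalityI subsetI)
    fix B assume "B \<in> ?P"
    then obtain A where B: "B = {f \<in> (\<Pi>\<^sub>E i\<in>s. {0<..1}). \<forall>i\<in>s. f i \<in> A i}" and "\<forall>i\<in>s. A i \<in> ?E"
      by auto
    then have "\<forall>i\<in>s. \<exists>b\<in>{0..1}. A i = {0<..b}" by blast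
    then obtain b where b: "\<And>i. i \<in> s \<Longrightarrow> b i \<in> {0..1} \<and> A i = {0<..b i}"
      by metis
    have b': "restrict b s \<in> unit_cube s"
      using b by (auto simp: mem_unit_cube)
    have "B = box_oc s (\<lambda>_. 0) (\<lambda>_. 1) \<inter> box_oc s (\<lambda>_. 0) b"
      using b by (auto simp: B mem_box_oc PiE_iff)
    also have "\<dots> = box_oc s (\<lambda>_. 0) (restrict b s)"
      using box_oc_subset_unit[OF b'] by (simp add: Int_absorb1)
    finally show "B \<in> box_oc s (\<lambda>_. 0) ` unit_cube s"
      using b' by (rule image_eqI)
  next
    fix B assume "B \<in> box_oc s (\<lambda>_. 0) ` unit_cube s"
    then obtain b where b: "b \<in> unit_cube s" "B = box_oc s (\<lambda>_. 0) b" by auto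
    have "B = box_oc s (\<lambda>_. 0) (\<lambda>_. 1) \<inter> box_oc s (\<lambda>_. 0) b"
      unfolding b(2) using box_oc_subset_unit[OF b(1)] by auto
    then have "B = {f \<in> (\<Pi>\<^sub>E i\<in>s. {0<..1}). \<forall>i\<in>s. f i \<in> {0<..b i}}"
      by (auto simp: mem_box_oc PiE_iff)
    moreover have "(\<lambda>i. {0<..b i}) \<in> Pi s (\<lambda>_. ?E)"
      using b by (auto simp: unit_cube_def)
    ultimately show "B \<in> ?P"
      by (intro CollectI exI[of _ "\<lambda>i. {0<..b i}"] exI[of _ s] conjI singletonI)
  qed
  also have "sets (sigma (\<Pi>\<^sub>E i\<in>s. {0<..1}) (box_oc s (\<lambda>_. 0) ` unit_cube s)) =
      sigma_sets (box_oc s (\<lambda>_. 0) (\<lambda>_. 1)) (box_oc s (\<lambda>_. 0) ` unit_cube s)"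
    using box_oc_subset_unit[of _ s] by (subst sets_measure_of) (auto simp: box_oc_def)
  finally show ?thesis .
qed

lemma Int_stable_boxes: "Int_stable (box_oc s (\<lambda>_. 0) ` unit_cube s)"
proof (rule Int_stableI, clarify)
  fix a b assume "a \<in> unit_cube s" "b \<in> unit_cube s"
  then show "box_oc s (\<lambda>_. 0) a \<inter> box_oc s (\<lambda>_. 0) b \<in> box_oc s (\<lambda>_. 0) ` unit_cube s"
    by (intro image_eqI[of _ _ "\<lambda>i\<in>s. min (a i) (b i)"])
      (auto simp: mem_box_oc mem_unit_cube min_le_iff_disj)
qed

section \<open>Uniqueness of the generated signed measure\<close>

lemma signed_measure_Un:
  assumes \<nu>: "signed_measure M \<nu>" and "A \<in> sets M" "B \<in> sets M" "A \<inter> B = {}"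
  shows "\<nu> (A \<union> B) = \<nu> A + \<nu> B"
proof -
  let ?F = "binaryset A B"
  have "range ?F \<subseteq> sets M" "disjoint_family ?F"
    using assms by (auto simp: range_binaryset_eq disjoint_family_on_def binaryset_def)
  then have "(\<lambda>i. \<nu> (?F i)) sums \<nu> (\<Union>i. ?F i)"
    using \<nu> by (auto simp: signed_measure_def)
  moreover have "(\<lambda>i. \<nu> (?F i)) sums (\<nu> A + \<nu> B)"
    using \<nu> by (intro binaryset_sums) (simp add: signed_measure_def)
  ultimately show ?thesis
    using sums_unique2 by (fastforce simp: UN_binaryset_eq)
qed

lemma signed_measure_Diff:
  assumes "signed_measure M \<nu>" "A \<in> sets M" "B \<in> sets M" "B \<subseteq> A"
  shows "\<nu> (A - B) = \<nu> A - \<nu> B"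
proof -
  have "(A - B) \<union> B = A" "(A - B) \<inter> B = {}" using assms(4) by auto
  then show ?thesis
    using signed_measure_Un[OF assms(1), of "A - B" B] assms by auto
qed

text \<open>Dynkin argument: \<open>gen_diff\<close> prescribes both values on boxes anchored at 0,
  and agreement passes to complements and disjoint unions. Non-measurable sets carry the value 0 by
  convention, so the two are equal as functions, which is what the definite description in
  \<open>gen_measure\<close> needs.\<close>

lemma generates_unique:
  assumes fin: "finite s" and \<nu>: "generates s G \<nu>" and \<nu>': "generates s G \<nu>'"
  shows "\<nu> = \<nu>'"
proof
  fix A
  have sm: "signed_measure (mu s) \<nu>" "signed_measure (mu s) \<nu>'"
    using \<nu> \<nu>' by (auto simp: generates_def)
  have box: "\<nu> (box_oc s (\<lambda>_. 0) b) = \<nu>' (box_oc s (\<lambda>_. 0) b)" if "b \<in> unit_cube s" for b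
  proof -
    \<comment> \<open>Corners have to be extensional to lie in \<open>unit_cube s\<close>; the box
      only sees their coordinates in \<open>s\<close>.\<close>
    have "restrict (\<lambda>_. 0) s \<in> unit_cube s" "\<forall>j\<in>s. restrict (\<lambda>_. 0) s j \<le> b j"
      using that by (auto simp: unit_cube_def)
    then have "\<nu> (box_oc s (restrict (\<lambda>_. 0) s) b) = gen_diff s G (restrict (\<lambda>_. 0) s) b"
      "\<nu>' (box_oc s (restrict (\<lambda>_. 0) s) b) = gen_diff s G (restrict (\<lambda>_. 0) s) b"
      using \<nu> \<nu>' that unfolding generates_def by blast+
    then show ?thesis by simp
  qed
  show "\<nu> A = \<nu>' A"
  proof (cases "A \<in> sets (mu s)")
    case False
    then show ?thesis using sm by (simp add: signed_measure_def)
  next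
    case True
    let ?\<Omega> = "box_oc s (\<lambda>_. 0) (\<lambda>_. 1::real)"
    have closed: "box_oc s (\<lambda>_. 0) ` unit_cube s \<subseteq> Pow ?\<Omega>"
      using box_oc_subset_unit by auto
    have \<Omega>: "\<nu> ?\<Omega> = \<nu>' ?\<Omega>"
      using box[of "restrict (\<lambda>_. 1) s"] by (simp add: unit_cube_def)
    have top: "?\<Omega> \<in> sets (mu s)" using space_mu[OF fin] sets.top[of "mu s"] by simp
    from True have "A \<in> sigma_sets ?\<Omega> (box_oc s (\<lambda>_. 0) ` unit_cube s)"
      by (simp add: sets_mu_boxes[OF fin])
    with Int_stable_boxes closed show ?thesis
    proof (induction rule: sigma_sets_induct_disjoint)
      case (basic A) then show ?case using box by auto
    next
      case empty then show ?case using sm by (simp add: signed_measure_def)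
    next
      case (compl A)
      then have "A \<in> sets (mu s)" by (simp add: sets_mu_boxes[OF fin])
      moreover from this have "A \<subseteq> ?\<Omega>" using sets.sets_into_space space_mu[OF fin] by blast
      ultimately show ?case
        using sm compl \<Omega> top by (simp add: signed_measure_Diff)
    next
      case (union F)
      then have "range F \<subseteq> sets (mu s)" by (simp add: sets_mu_boxes[OF fin])
      then have "(\<lambda>i. \<nu> (F i)) sums \<nu> (\<Union>i. F i)" "(\<lambda>i. \<nu>' (F i)) sums \<nu>' (\<Union>i. F i)"
        using sm union(1) by (simp_all add: signed_measure_def)
      then show ?case using union(3) sums_unique2 by auto
    qed
  qed
qed

lemma generates_gen_measure:
  assumes "finite s" "generates s G \<nu>"
  shows "generates s G (gen_measure s G)"
  unfolding gen_measure_def by (rule theI[of _ \<nu>]) (use assms generates_unique in blast)+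


section \<open>Jordan decomposition of signed measures\<close>

lemma signed_measure_sums:
  "\<lbrakk>signed_measure M \<nu>; range A \<subseteq> sets M; disjoint_family A\<rbrakk> \<Longrightarrow> (\<lambda>i. \<nu> (A i)) sums \<nu> (\<Union>i. A i)"
  by (simp add: signed_measure_def)

context
  fixes M :: "'a measure" and \<nu> :: "'a set \<Rightarrow> real"
  assumes \<nu>: "signed_measure M \<nu>"
begin

abbreviation (input) sup_pos :: "'a set \<Rightarrow> ennreal" where
  "sup_pos A \<equiv> SUP B\<in>{B \<in> sets M. B \<subseteq> A}. ennreal (\<nu> B)"

lemma signed_measure_empty: "\<nu> {} = 0"
  using \<nu> by (simp add: signed_measure_def)

text \<open>The union of a competitor for \<open>A\<close> and one for \<open>C\<close> is a
  competitor for \<open>A \<union> C\<close>, and \<open>\<nu>\<close> is additive on it because the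
  two are disjoint.\<close>

lemma sup_pos_add:
  assumes "A \<in> sets M" "C \<in> sets M" "A \<inter> C = {}"
  shows "sup_pos A + sup_pos C \<le> sup_pos (A \<union> C)"
proof -
  have *: "ennreal (\<nu> B) + ennreal (\<nu> D) \<le> sup_pos (A \<union> C)"
    if B: "B \<in> sets M" "B \<subseteq> A" and D: "D \<in> sets M" "D \<subseteq> C" for B D
  proof -
    \<comment> \<open>\<open>ennreal\<close> truncates negative values to 0, so a competitor of
      negative mass may be replaced by the empty set; the remaining values are nonnegative and
      \<open>ennreal\<close> is additive on them.\<close>
    let ?B = "if 0 \<le> \<nu> B then B else {}" and ?D = "if 0 \<le> \<nu> D then D else {}"
    have "ennreal (\<nu> B) + ennreal (\<nu> D) = ennreal (\<nu> ?B) + ennreal (\<nu> ?D)"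
      by (auto simp: signed_measure_empty ennreal_neg)
    also have "\<dots> = ennreal (\<nu> ?B + \<nu> ?D)"
      by (subst ennreal_plus) (auto simp: signed_measure_empty)
    also have "\<nu> ?B + \<nu> ?D = \<nu> (?B \<union> ?D)"
      by (rule signed_measure_Un[OF \<nu>, symmetric]) (use B D assms(3) in auto)
    also have "ennreal \<dots> \<le> sup_pos (A \<union> C)"
      by (rule SUP_upper) (use B D in auto)
    finally show ?thesis .
  qed
  have ne: "{B \<in> sets M. B \<subseteq> X} \<noteq> {}" for X by auto
  have "sup_pos A + sup_pos C =
      (SUP D\<in>{D \<in> sets M. D \<subseteq> C}. SUP B\<in>{B \<in> sets M. B \<subseteq> A}. ennreal (\<nu> B) + ennreal (\<nu> D))"
    by (simp add: ennreal_SUP_add_left[OF ne] ennreal_SUP_add_right[OF ne])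
  also have "\<dots> \<le> sup_pos (A \<union> C)"
    by (intro SUP_least) (use * in auto)
  finally show ?thesis .
qed

lemma sup_pos_mono: "A \<subseteq> C \<Longrightarrow> sup_pos A \<le> sup_pos C"
  by (rule SUP_subset_mono) auto

text \<open>Countable additivity of the supremum: superadditivity on finite disjoint unions gives
  one inequality in the limit; for the other, a competitor for the union is cut along the pieces and
  \<open>\<nu>\<close> is countably additive on the cuts.\<close>

lemma emeasure_pos_variation:
  assumes "A \<in> sets M"
  shows "emeasure (pos_variation M \<nu>) A = sup_pos A"
proof (rule emeasure_measure_of[OF pos_variation_def])
  show "sets M \<subseteq> Pow (space M)" by (rule sets.space_closed)
  show "A \<in> sets (pos_variation M \<nu>)" using assms by (simp add: pos_variation_def)
  have "{B \<in> sets M. B \<subseteq> {}} = {{}}" by auto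
  then show "positive (sets (pos_variation M \<nu>)) (\<lambda>A. sup_pos A)"
    by (simp add: positive_def signed_measure_empty)
  show "countably_additive (sets (pos_variation M \<nu>)) (\<lambda>A. sup_pos A)"
  proof (rule countably_additiveI)
    fix A :: "nat \<Rightarrow> 'a set"
    assume "range A \<subseteq> sets (pos_variation M \<nu>)" and disj: "disjoint_family A"
    then have A: "\<And>i. A i \<in> sets M" by (auto simp: pos_variation_def)
    have "(\<Sum>i<n. sup_pos (A i)) \<le> sup_pos (\<Union>i<n. A i)" for n
    proof (induction n)
      case (Suc n)
      have "(\<Sum>i<Suc n. sup_pos (A i)) \<le> sup_pos (\<Union>i<n. A i) + sup_pos (A n)"
        using Suc by (simp add: add_right_mono)
      also have "\<dots> \<le> sup_pos ((\<Union>i<n. A i) \<union> A n)"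
      proof (rule sup_pos_add)
        have "A i \<inter> A n = {}" if "i < n" for i
          using disjoint_family_onD[OF disj, of i n] that by auto
        then show "(\<Union>i<n. A i) \<inter> A n = {}" by blast
      qed (use A in auto)
      also have "(\<Union>i<n. A i) \<union> A n = (\<Union>i<Suc n. A i)" by (auto simp: less_Suc_eq)
      finally show ?case .
    qed simp
    then have "(\<Sum>i<n. sup_pos (A i)) \<le> sup_pos (\<Union>i. A i)" for n
      by (rule order_trans) (rule sup_pos_mono, auto)
    then have "(\<Sum>i. sup_pos (A i)) \<le> sup_pos (\<Union>i. A i)"
      by (intro suminf_le_const) auto
    moreover have "sup_pos (\<Union>i. A i) \<le> (\<Sum>i. sup_pos (A i))"
    proof (rule SUP_least, clarify)
      fix B assume B: "B \<in> sets M" "B \<subseteq> (\<Union>i. A i)"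
      let ?F = "\<lambda>i. B \<inter> A i"
      have "disjoint_family ?F"
        by (rule disjoint_family_on_bisimulation[OF disj]) auto
      moreover have "range ?F \<subseteq> sets M" using A B by auto
      ultimately have "(\<lambda>i. \<nu> (?F i)) sums \<nu> (\<Union>i. ?F i)"
        by (intro signed_measure_sums[OF \<nu>])
      also have "(\<Union>i. ?F i) = B" using B by auto
      finally have "(\<lambda>i. \<nu> (?F i)) sums \<nu> B" .
      then have "(\<lambda>n. ennreal (\<Sum>i<n. \<nu> (?F i))) \<longlonglongrightarrow> ennreal (\<nu> B)"
        by (intro tendsto_ennrealI) (simp add: sums_def)
      moreover have "ennreal (\<Sum>i<n. \<nu> (?F i)) \<le> (\<Sum>i. sup_pos (A i))" for n
      proof -
        \<comment> \<open>The cuts may have masses of both signs, and \<open>ennreal\<close>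
          commutes with sums only for nonnegative terms, hence the passage to positive
          parts.\<close>
        have "ennreal (\<Sum>i<n. \<nu> (?F i)) \<le> ennreal (\<Sum>i<n. max 0 (\<nu> (?F i)))"
          by (intro ennreal_leI sum_mono) simp
        also have "\<dots> = (\<Sum>i<n. ennreal (max 0 (\<nu> (?F i))))"
          by (subst sum_ennreal) auto
        also have "\<dots> \<le> (\<Sum>i<n. sup_pos (A i))"
          by (intro sum_mono) (use A B in \<open>auto intro!: SUP_upper simp: max_def ennreal_neg\<close>)
        also have "\<dots> \<le> (\<Sum>i. sup_pos (A i))"
          by (intro sum_le_suminf) auto
        finally show ?thesis .
      qed
      ultimately show "ennreal (\<nu> B) \<le> (\<Sum>i. sup_pos (A i))"
        by (intro LIMSEQ_le_const2) auto
    qed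
    ultimately show "(\<Sum>i. sup_pos (A i)) = sup_pos (\<Union>i. A i)" by (rule antisym)
  qed
qed

end

lemma signed_measure_uminus:
  assumes "signed_measure M \<nu>" shows "signed_measure M (\<lambda>A. - \<nu> A)"
  using assms by (auto simp: signed_measure_def intro: sums_minus)

lemma space_variation [simp]: "space (pos_variation M \<nu>) = space M" "space (neg_variation M \<nu>) = space M"
  by (simp_all add: pos_variation_def neg_variation_def space_measure_of sets.space_closed)

lemma sets_variation [simp, measurable_cong]:
  "sets (pos_variation M \<nu>) = sets M" "sets (neg_variation M \<nu>) = sets M"
  by (simp_all add: pos_variation_def neg_variation_def)

lemma finite_measure_variation:
  assumes "total_variation M \<nu> < \<infinity>"
  shows "finite_measure (pos_variation M \<nu>)" "finite_measure (neg_variation M \<nu>)"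
  using assms by (auto intro!: finite_measureI simp: total_variation_def)

text \<open>For B inside A, \<open>\<nu> B\<close> equals \<open>\<nu> A\<close> minus
  \<open>\<nu> (A - B)\<close>, which is at most \<open>\<nu> A\<close> plus the negative variation.
  The supremum over B gives one inequality, the same argument for \<open>- \<nu>\<close> the other;
  finite total variation makes the suprema real numbers that can be subtracted.\<close>

lemma jordan_decomposition:
  assumes \<nu>: "signed_measure M \<nu>" and fin: "total_variation M \<nu> < \<infinity>" and A: "A \<in> sets M"
  shows "\<nu> A = measure (pos_variation M \<nu>) A - measure (neg_variation M \<nu>) A"
proof -
  let ?p = "measure (pos_variation M \<nu>) A" and ?n = "measure (neg_variation M \<nu>) A"
  interpret p: finite_measure "pos_variation M \<nu>" by (rule finite_measure_variation[OF fin])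
  interpret n: finite_measure "neg_variation M \<nu>" by (rule finite_measure_variation[OF fin])
  have p: "ennreal ?p = (SUP B\<in>{B \<in> sets M. B \<subseteq> A}. ennreal (\<nu> B))"
    using emeasure_pos_variation[OF \<nu> A] by (simp add: p.emeasure_eq_measure)
  have n: "ennreal ?n = (SUP B\<in>{B \<in> sets M. B \<subseteq> A}. ennreal (- \<nu> B))"
    using emeasure_pos_variation[OF signed_measure_uminus[OF \<nu>] A]
    by (simp add: n.emeasure_eq_measure flip: neg_variation_def)
  have le_p: "\<nu> B \<le> ?p" and le_n: "- \<nu> B \<le> ?n" if "B \<in> sets M" "B \<subseteq> A" for B
  proof -
    have "ennreal (\<nu> B) \<le> ennreal ?p" unfolding p by (rule SUP_upper) (use that in auto)
    then show "\<nu> B \<le> ?p" by (simp add: ennreal_le_iff)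
    have "ennreal (- \<nu> B) \<le> ennreal ?n" unfolding n by (rule SUP_upper) (use that in auto)
    then show "- \<nu> B \<le> ?n" by (simp add: ennreal_le_iff)
  qed
  have compl: "\<nu> (A - B) = \<nu> A - \<nu> B" if "B \<in> sets M" "B \<subseteq> A" for B
    using signed_measure_Diff[OF \<nu> A that] .
  have "ennreal ?p \<le> ennreal (\<nu> A + ?n)"
    unfolding p
  proof (intro SUP_least ennreal_leI)
    fix B assume "B \<in> {B \<in> sets M. B \<subseteq> A}"
    then show "\<nu> B \<le> \<nu> A + ?n" using le_n[of "A - B"] compl[of B] A by auto
  qed
  \<comment> \<open>An \<open>ennreal\<close> inequality is reflected to the reals only if the
    right-hand side is nonnegative; here A itself is the competitor.\<close>
  moreover have "0 \<le> \<nu> A + ?n" using le_n[OF A] by simp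
  ultimately have "?p \<le> \<nu> A + ?n" by (simp add: ennreal_le_iff)
  have "ennreal ?n \<le> ennreal (?p - \<nu> A)"
    unfolding n
  proof (intro SUP_least ennreal_leI)
    fix B assume "B \<in> {B \<in> sets M. B \<subseteq> A}"
    then show "- \<nu> B \<le> ?p - \<nu> A" using le_p[of "A - B"] compl[of B] A by auto
  qed
  moreover have "0 \<le> ?p - \<nu> A" using le_p[OF A] by simp
  ultimately have "?n \<le> ?p - \<nu> A" by (simp add: ennreal_le_iff)
  with \<open>?p \<le> \<nu> A + ?n\<close> show ?thesis by simp
qed


section \<open>Iterated primitives and splines\<close>

text \<open>A class of integrands closed under products, primitives and composition with coordinate
  restrictions, and contained in the integrable functions because \<open>mu s\<close> is finite. The
  bound holds everywhere rather than almost everywhere, so no null sets have to be followed through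
  these operations.\<close>

definition bounded_on_mu :: "nat set \<Rightarrow> ((nat \<Rightarrow> real) \<Rightarrow> real) \<Rightarrow> bool" where
  "bounded_on_mu s G \<longleftrightarrow> G \<in> borel_measurable (mu s) \<and> (\<exists>B. \<forall>v\<in>space (mu s). \<bar>G v\<bar> \<le> B)"

lemma spline_bounds:
  assumes "finite s" "\<forall>l\<in>s. 0 \<le> u l" "\<forall>l\<in>s. x l \<le> 1"
  shows "0 \<le> spline j s u x" "spline j s u x \<le> 1"
proof -
  have "(if u l \<le> x l then (x l - u l) ^ j / fact j else 0) \<in> {0..1}" if "l \<in> s" for l
  proof -
    have "0 \<le> u l" "x l \<le> 1" using that assms by auto
    then have "u l \<le> x l \<Longrightarrow> (x l - u l) ^ j \<le> 1" by (intro power_le_one) auto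
    moreover have "(1::real) \<le> fact j" by (simp add: fact_ge_1)
    ultimately show ?thesis by (auto simp: divide_le_eq_1 intro: order_trans)
  qed
  then show "0 \<le> spline j s u x" "spline j s u x \<le> 1"
    by (auto simp: spline_closed_form[OF assms] intro!: prod_nonneg prod_le_1)
qed

lemma space_mu_bounds: "finite s \<Longrightarrow> v \<in> space (mu s) \<Longrightarrow> l \<in> s \<Longrightarrow> 0 < v l \<and> v l \<le> 1"
  by (simp add: space_mu mem_box_oc)

lemma space_mu_unit_cube: "finite s \<Longrightarrow> v \<in> space (mu s) \<Longrightarrow> v \<in> unit_cube s"
  by (auto simp: space_mu mem_box_oc mem_unit_cube intro: less_imp_le)

lemma measurable_spline_pair:
  assumes "finite s" and N[measurable_cong]: "sets N = sets (mu s)"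
  shows "(\<lambda>(v, u). spline j s u v) \<in> borel_measurable (mu s \<Otimes>\<^sub>M N)"
proof -
  have sp: "space N = space (mu s)" using N by (rule sets_eq_imp_space_eq)
  have "snd \<in> mu s \<Otimes>\<^sub>M N \<rightarrow>\<^sub>M mu s" "fst \<in> mu s \<Otimes>\<^sub>M N \<rightarrow>\<^sub>M mu s"
    using measurable_snd[of "mu s" N] measurable_cong_sets[OF refl N] by auto
  note [measurable] = this[THEN measurable_mu_component, OF assms(1)]
  have "(\<lambda>w. \<Prod>l\<in>s. if snd w l \<le> fst w l then (fst w l - snd w l) ^ j / fact j else 0)
      \<in> borel_measurable (mu s \<Otimes>\<^sub>M N)"
    using assms(1) by measurable
  also have "?this \<longleftrightarrow> ?thesis"
  proof (rule measurable_cong)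
    fix w assume "w \<in> space (mu s \<Otimes>\<^sub>M N)"
    then have "fst w \<in> space (mu s)" "snd w \<in> space (mu s)"
      by (auto simp: space_pair_measure sp)
    then have "\<forall>l\<in>s. 0 \<le> snd w l" "\<forall>l\<in>s. fst w l \<le> 1"
      using space_mu_bounds[OF assms(1)] by (simp_all add: less_imp_le)
    from spline_closed_form[OF assms(1) this]
    show "(\<Prod>l\<in>s. if snd w l \<le> fst w l then (fst w l - snd w l) ^ j / fact j else 0) =
        (case w of (v, u) \<Rightarrow> spline j s u v)"
      by (simp add: split_beta)
  qed
  finally show ?thesis .
qed

lemma measurable_spline:
  assumes "finite s" "\<forall>l\<in>s. x l \<le> 1"
  shows "(\<lambda>u. spline j s u x) \<in> borel_measurable (mu s)"
proof -
  note [measurable] = measurable_mu_component[OF measurable_ident assms(1), unfolded id_def]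
  have "(\<lambda>u. \<Prod>l\<in>s. if u l \<le> x l then (x l - u l) ^ j / fact j else 0) \<in> borel_measurable (mu s)"
    using assms(1) by measurable
  also have "?this \<longleftrightarrow> ?thesis"
    by (rule measurable_cong)
      (use assms in \<open>auto simp: space_mu_bounds less_imp_le spline_closed_form\<close>)
  finally show ?thesis .
qed

text \<open>One-dimensional core of \<open>integral_spline\<close>: the power is integrated in its
  upper argument, from 0, with the factor vanishing below \<open>u\<close>.\<close>

lemma integral_power_Icc:
  fixes u x :: real
  assumes "0 \<le> u" "x \<le> 1"
  shows "has_bochner_integral unit_lborel
    (\<lambda>v. indicator {0<..x} v * (if u \<le> v then (v - u) ^ j / fact j else 0))
    (if u \<le> x then (x - u) ^ Suc j / fact (Suc j) else 0)"
proof (cases "u \<le> x")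
  case True
  let ?f = "\<lambda>v. (v - u) ^ j / fact j" and ?F = "\<lambda>v. (v - u) ^ Suc j / fact (Suc j)"
  have "has_bochner_integral lborel (\<lambda>v. indicator {u..x} v *\<^sub>R ?f v) (?F x - ?F u)"
  proof (rule has_bochner_integral_FTC_Icc[OF True])
    show "(?F has_vector_derivative ?f v) (at v within {u..x})" for v
      unfolding has_real_derivative_iff_has_vector_derivative[symmetric]
      by (rule derivative_eq_intros refl | simp)+
    show "continuous_on {u..x} ?f" by (intro continuous_intros) auto
  qed
  also have "has_bochner_integral lborel (\<lambda>v. indicator {u..x} v *\<^sub>R ?f v) (?F x - ?F u) \<longleftrightarrow>
    has_bochner_integral lborel (\<lambda>v. indicator {0<..1} v *\<^sub>R
      (indicator {0<..x} v * (if u \<le> v then (v - u) ^ j / fact j else 0))) (?F x - ?F u)"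
  proof (rule has_bochner_integral_cong_AE)
    \<comment> \<open>The two integrands can differ only at v = 0, and only if u = 0: [u,x] contains
      that point, (0,x] does not.\<close>
    show "AE v in lborel. indicator {u..x} v *\<^sub>R ?f v = indicator {0<..1} v *\<^sub>R
      (indicator {0<..x} v * (if u \<le> v then (v - u) ^ j / fact j else 0))"
      by (rule AE_mp[OF AE_lborel_singleton[of 0]], rule AE_I2)
        (use assms in \<open>auto simp: indicator_def\<close>)
  qed measurable
  finally show ?thesis
    using True unfolding unit_lborel_def by (subst has_bochner_integral_restrict_space) auto
next
  case False
  then have "(\<lambda>v. indicator {0<..x} v * (if u \<le> v then (v - u) ^ j / fact j else 0)) = (\<lambda>_. 0)"
    by (auto simp: indicator_def)
  then show ?thesis using False by (simp add: has_bochner_integral_zero)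
qed

text \<open>The recursion of \<open>spline\<close> integrates the lower argument, while
  \<open>primitive\<close> integrates the upper one. Coordinatewise both produce the same power of x
  - u with the same factorial, so a primitive raises the order by one.\<close>

lemma integral_spline:
  assumes fin: "finite s" and u: "\<forall>l\<in>s. 0 \<le> u l" and x: "\<forall>l\<in>s. 0 \<le> x l \<and> x l \<le> 1"
  shows "(LINT v:box_oc s (\<lambda>_. 0) x|mu s. spline j s u v) = spline (Suc j) s u x"
proof -
  let ?f = "\<lambda>l v. indicator {0<..x l} v * (if u l \<le> v then (v - u l) ^ j / fact j else 0)"
  have "(LINT v:box_oc s (\<lambda>_. 0) x|mu s. spline j s u v) = (LINT v|mu s. (\<Prod>l\<in>s. ?f l (v l)))"
    unfolding set_lebesgue_integral_def
  proof (rule Bochner_Integration.integral_cong[OF refl])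
    fix v assume v: "v \<in> space (mu s)"
    then have b: "\<forall>l\<in>s. 0 < v l \<and> v l \<le> 1" "v \<in> extensional s"
      using fin by (auto simp: space_mu mem_box_oc)
    show "indicator (box_oc s (\<lambda>_. 0) x) v *\<^sub>R spline j s u v = (\<Prod>l\<in>s. ?f l (v l))"
    proof (cases "v \<in> box_oc s (\<lambda>_. 0) x")
      case True
      then show ?thesis using b u fin
        by (auto simp: spline_closed_form mem_box_oc intro!: prod.cong)
    next
      case False
      then obtain l where "l \<in> s" "\<not> v l \<le> x l" using b by (auto simp: mem_box_oc)
      then have "(\<Prod>l\<in>s. ?f l (v l)) = 0"
        using fin by (intro prod_zero) (auto intro!: bexI[of _ l])
      with False show ?thesis by simp
    qed
  qed
  also have "\<dots> = (\<Prod>l\<in>s. LINT v|unit_lborel. ?f l v)"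
    unfolding mu_eq_PiM[OF fin]
    by (rule unit_product.product_integral_prod[OF fin])
      (use u x in \<open>blast intro: integrable.intros integral_power_Icc\<close>)
  also have "\<dots> = (\<Prod>l\<in>s. if u l \<le> x l then (x l - u l) ^ Suc j / fact (Suc j) else 0)"
    by (rule prod.cong[OF refl])
      (use u x in \<open>blast intro: has_bochner_integral_integral_eq integral_power_Icc\<close>)
  also have "\<dots> = spline (Suc j) s u x"
    by (rule spline_closed_form[symmetric]) (use fin u x in auto)
  finally show ?thesis .
qed

lemma bounded_on_mu_integrable:
  assumes "finite s" "bounded_on_mu s G" shows "integrable (mu s) G"
proof -
  interpret finite_measure "mu s" using finite_measure_mu[OF assms(1)] .
  from assms(2) obtain B where "G \<in> borel_measurable (mu s)" "\<forall>v\<in>space (mu s). \<bar>G v\<bar> \<le> B"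
    by (auto simp: bounded_on_mu_def)
  then show ?thesis by (intro integrable_const_bound[of _ B]) auto
qed

lemma bounded_on_mu_cong:
  assumes "bounded_on_mu s F" "\<And>v. v \<in> space (mu s) \<Longrightarrow> G v = F v"
  shows "bounded_on_mu s G"
  using assms measurable_cong[of "mu s" G F borel] by (auto simp: bounded_on_mu_def)

lemma bounded_on_mu_diff:
  assumes "bounded_on_mu s F" "bounded_on_mu s G"
  shows "bounded_on_mu s (\<lambda>v. F v - G v)"
proof -
  obtain A B where *: "F \<in> borel_measurable (mu s)" "\<And>v. v \<in> space (mu s) \<Longrightarrow> \<bar>F v\<bar> \<le> A"
    "G \<in> borel_measurable (mu s)" "\<And>v. v \<in> space (mu s) \<Longrightarrow> \<bar>G v\<bar> \<le> B"
    using assms by (auto simp: bounded_on_mu_def)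
  have "\<bar>F v - G v\<bar> \<le> A + B" if "v \<in> space (mu s)" for v
    using *(2,4)[OF that] by linarith
  with * show ?thesis by (auto simp: bounded_on_mu_def)
qed

lemma bounded_on_mu_set_integrable:
  assumes "finite s" "bounded_on_mu s G" "x \<in> unit_cube s"
  shows "set_integrable (mu s) (box_oc s (\<lambda>_. 0) x) G"
  unfolding set_integrable_def
  by (rule integrable_mult_indicator[OF box_oc_sets_mu bounded_on_mu_integrable]) (use assms in auto)

text \<open>\<open>mu s\<close> has mass 1, so a bound for the integrand is a bound for the
  primitive; measurability is that of an integral depending on a parameter.\<close>

lemma bounded_on_mu_primitive:
  assumes fin: "finite s" and G: "bounded_on_mu s G"
  shows "bounded_on_mu s (primitive j s G)"
proof (induction j)
  case 0 then show ?case using G by (simp add: bounded_on_mu_def)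
next
  case (Suc j)
  interpret finite_measure "mu s" using finite_measure_mu[OF fin] .
  let ?P = "primitive j s G"
  from Suc obtain B where P[measurable]: "?P \<in> borel_measurable (mu s)"
    and B: "\<And>v. v \<in> space (mu s) \<Longrightarrow> \<bar>?P v\<bar> \<le> B"
    by (auto simp: bounded_on_mu_def)
  \<comment> \<open>On the space of \<open>mu s\<close>, membership in the box reduces to
    coordinatewise comparison with x, a condition jointly measurable in x and u.\<close>
  have eq: "primitive (Suc j) s G x = (LINT u|mu s. (if \<forall>l\<in>s. u l \<le> x l then ?P u else 0))"
    if "x \<in> space (mu s)" for x
    unfolding primitive.simps set_lebesgue_integral_def
    by (rule Bochner_Integration.integral_cong[OF refl])
      (auto simp: space_mu fin mem_box_oc indicator_def)
  note [measurable] = measurable_mu_component[OF measurable_snd fin, of _ "mu s"]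
    measurable_mu_component[OF measurable_fst fin, of _ "mu s"]
  have "(\<lambda>x. LINT u|mu s. (if \<forall>l\<in>s. u l \<le> x l then ?P u else 0)) \<in> borel_measurable (mu s)"
    by (rule borel_measurable_lebesgue_integral) (use fin in \<open>unfold split_beta', measurable\<close>)
  then have "primitive (Suc j) s G \<in> borel_measurable (mu s)"
    using eq by (subst measurable_cong)
  moreover have "\<bar>primitive (Suc j) s G x\<bar> \<le> B" if x: "x \<in> space (mu s)" for x
  proof -
    have "0 \<le> B" using B[OF x] by linarith
    have "set_integrable (mu s) (box_oc s (\<lambda>_. 0) x) ?P"
      by (rule bounded_on_mu_set_integrable[OF fin Suc space_mu_unit_cube[OF fin x]])
    then have "integrable (mu s) (\<lambda>u. \<bar>indicator (box_oc s (\<lambda>_. 0) x) u *\<^sub>R ?P u\<bar>)"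
      by (simp add: set_integrable_def)
    then have "\<bar>primitive (Suc j) s G x\<bar> \<le> (LINT u|mu s. B)"
      unfolding primitive.simps set_lebesgue_integral_def
      by (intro order_trans[OF integral_abs_bound] integral_mono)
        (use B \<open>0 \<le> B\<close> in \<open>auto simp: indicator_def\<close>)
    also have "\<dots> = B" using fin by (simp add: measure_def emeasure_mu_space)
    finally show ?thesis .
  qed
  ultimately show ?case unfolding bounded_on_mu_def by blast
qed

lemma box_oc_unit_cube: "x \<in> unit_cube s \<Longrightarrow> v \<in> box_oc s (\<lambda>_. 0) x \<Longrightarrow> v \<in> unit_cube s"
  by (fastforce simp: mem_box_oc mem_unit_cube)

lemma set_integral_box_cong:
  assumes "x \<in> unit_cube s" "\<And>v. v \<in> unit_cube s \<Longrightarrow> f v = (g v :: real)"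
  shows "(LINT v:box_oc s (\<lambda>_. 0) x|M. f v) = (LINT v:box_oc s (\<lambda>_. 0) x|M. g v)"
  unfolding set_lebesgue_integral_def
proof (rule Bochner_Integration.integral_cong[OF refl])
  fix v
  show "indicator (box_oc s (\<lambda>_. 0) x) v *\<^sub>R f v = indicator (box_oc s (\<lambda>_. 0) x) v *\<^sub>R g v"
    using assms(2) box_oc_unit_cube[OF assms(1), of v] by (cases "v \<in> box_oc s (\<lambda>_. 0) x") auto
qed

lemma primitive_cong:
  assumes "\<And>v. v \<in> unit_cube s \<Longrightarrow> F v = G v" "x \<in> unit_cube s"
  shows "primitive j s F x = primitive j s G x"
  using assms(2)
proof (induction j arbitrary: x)
  case 0 then show ?case using assms(1) by simp
next
  case (Suc j)
  then show ?case unfolding primitive.simps by (intro set_integral_box_cong)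
qed

lemma primitive_primitive: "primitive j s (primitive i s G) x = primitive (i + j) s G x"
  by (induction j arbitrary: x) simp_all

lemma primitive_diff:
  assumes fin: "finite s" and "bounded_on_mu s F" "bounded_on_mu s G" and "x \<in> unit_cube s"
  shows "primitive j s (\<lambda>v. F v - G v) x = primitive j s F x - primitive j s G x"
  using assms(4)
proof (induction j arbitrary: x)
  case (Suc j)
  have "primitive (Suc j) s (\<lambda>v. F v - G v) x =
      (LINT u:box_oc s (\<lambda>_. 0) x|mu s. primitive j s F u - primitive j s G u)"
    unfolding primitive.simps by (rule set_integral_box_cong[OF Suc.prems Suc.IH])
  then show ?case
    using Suc.prems by (simp add: assms set_integral_diff bounded_on_mu_set_integrable bounded_on_mu_primitive)
qed simp

lemma primitive_sum:
  assumes fin: "finite s" and F: "\<And>t. t \<in> T \<Longrightarrow> bounded_on_mu s (F t)" and "x \<in> unit_cube s"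
  shows "primitive j s (\<lambda>v. \<Sum>t\<in>T. F t v) x = (\<Sum>t\<in>T. primitive j s (F t) x)"
  using assms(3)
proof (induction j arbitrary: x)
  case (Suc j)
  have "primitive (Suc j) s (\<lambda>v. \<Sum>t\<in>T. F t v) x =
      (LINT u:box_oc s (\<lambda>_. 0) x|mu s. (\<Sum>t\<in>T. primitive j s (F t) u))"
    unfolding primitive.simps by (rule set_integral_box_cong[OF Suc.prems Suc.IH])
  also have "\<dots> =
      (LINT u|mu s. (\<Sum>t\<in>T. indicator (box_oc s (\<lambda>_. 0) x) u *\<^sub>R primitive j s (F t) u))"
    unfolding set_lebesgue_integral_def by (simp add: sum_distrib_left)
  also have "\<dots> = (\<Sum>t\<in>T. primitive (Suc j) s (F t) x)"
    unfolding primitive.simps set_lebesgue_integral_def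
    using bounded_on_mu_set_integrable[OF fin bounded_on_mu_primitive[OF fin F] Suc.prems]
    by (intro Bochner_Integration.integral_sum) (simp add: set_integrable_def)
  finally show ?case .
qed simp

section \<open>Fubini for integrals of splines\<close>

lemma bounded_on_mu_spline_integral:
  assumes fin: "finite s" and "finite_measure N" and N[measurable_cong]: "sets N = sets (mu s)"
  shows "bounded_on_mu s (\<lambda>v. LINT u|N. spline j s u v)"
proof -
  interpret N: finite_measure N by fact
  have sp: "space N = space (mu s)" using N by (rule sets_eq_imp_space_eq)
  have "\<bar>LINT u|N. spline j s u v\<bar> \<le> measure N (space N)" if v: "v \<in> space (mu s)" for v
  proof -
    have b: "\<bar>spline j s u v\<bar> \<le> 1" if "u \<in> space N" for u
      using spline_bounds[of s u v j] space_mu_bounds[OF fin v] space_mu_bounds[OF fin, of u] that fin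
      by (simp add: sp less_imp_le)
    have "(\<lambda>u. spline j s u v) \<in> borel_measurable N"
      using measurable_spline[OF fin, of v] space_mu_bounds[OF fin v] N by (simp cong: measurable_cong_sets)
    then have "integrable N (\<lambda>u. spline j s u v)"
      using b by (intro N.integrable_const_bound[of _ 1]) auto
    then have "\<bar>LINT u|N. spline j s u v\<bar> \<le> (LINT u|N. 1)"
      by (intro order_trans[OF integral_abs_bound] integral_mono) (use b in auto)
    then show ?thesis by simp
  qed
  moreover have "(\<lambda>v. LINT u|N. spline j s u v) \<in> borel_measurable (mu s)"
    by (rule N.borel_measurable_lebesgue_integral) (rule measurable_spline_pair[OF fin N])
  ultimately show ?thesis by (auto simp: bounded_on_mu_def)
qed

text \<open>Each primitive passes under the integral against \<open>N\<close> by Fubini, both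
  measures being finite and the integrand bounded by 1, and there raises the order of the spline by
  \<open>integral_spline\<close>. For i = 0 the starting function is the distribution function of
  \<open>N\<close>.\<close>

lemma primitive_spline_integral:
  assumes fin: "finite s" and fN: "finite_measure N" and N[measurable_cong]: "sets N = sets (mu s)"
    and "x \<in> unit_cube s"
  shows "primitive j s (\<lambda>v. LINT u|N. spline i s u v) x = (LINT u|N. spline (i + j) s u x)"
  using assms(4)
proof (induction j arbitrary: x)
  case (Suc j)
  interpret N: finite_measure N by fact
  interpret mu: finite_measure "mu s" using finite_measure_mu[OF fin] .
  interpret pair_sigma_finite "mu s" N by standard
  interpret P: finite_measure "mu s \<Otimes>\<^sub>M N"
    by (rule finite_measure_pair_measure) (simp_all add: N.finite_measure_axioms mu.finite_measure_axioms)
  have sp: "space N = space (mu s)" using N by (rule sets_eq_imp_space_eq)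
  let ?B = "box_oc s (\<lambda>_. 0) x"
  have [measurable]: "?B \<in> sets (mu s)" using box_oc_sets_mu[OF fin Suc.prems] .
  note [measurable] = measurable_spline_pair[OF fin N]
  have int: "integrable (mu s \<Otimes>\<^sub>M N) (\<lambda>(v, u). indicator ?B v * spline (i + j) s u v)"
  proof (rule P.integrable_const_bound[of _ 1])
    show "AE w in mu s \<Otimes>\<^sub>M N. norm (case w of (v, u) \<Rightarrow> indicator ?B v * spline (i + j) s u v) \<le> 1"
      using spline_bounds[OF fin] space_mu_bounds[OF fin]
      by (intro AE_I2) (auto simp: space_pair_measure sp less_imp_le indicator_def)
  qed measurable
  have "primitive (Suc j) s (\<lambda>v. LINT u|N. spline i s u v) x =
      (LINT v:?B|mu s. LINT u|N. spline (i + j) s u v)"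
    unfolding primitive.simps by (rule set_integral_box_cong[OF Suc.prems Suc.IH])
  also have "\<dots> = (LINT v|mu s. LINT u|N. indicator ?B v * spline (i + j) s u v)"
    unfolding set_lebesgue_integral_def by simp
  also have "\<dots> = (LINT u|N. LINT v|mu s. indicator ?B v * spline (i + j) s u v)"
    using Fubini_integral[OF int] by simp
  also have "\<dots> = (LINT u|N. spline (i + Suc j) s u x)"
  proof (rule Bochner_Integration.integral_cong[OF refl])
    fix u assume "u \<in> space N"
    then show "(LINT v|mu s. indicator ?B v * spline (i + j) s u v) = spline (i + Suc j) s u x"
      using integral_spline[OF fin, of u x "i + j"] Suc.prems space_mu_bounds[OF fin, of u]
      by (simp add: sp set_lebesgue_integral_def mem_unit_cube less_imp_le del: spline.simps)
  qed
  finally show ?case .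
qed simp

section \<open>Functions depending on a subset of the coordinates\<close>

lemma measurable_restrict_mu:
  assumes "finite s" "t \<subseteq> s"
  shows "(\<lambda>v. restrict v t) \<in> mu s \<rightarrow>\<^sub>M mu t"
  using assms finite_subset[OF assms(2,1)] by (simp add: mu_eq_PiM measurable_restrict_subset)

lemma bounded_on_mu_restrict:
  assumes "finite s" "t \<subseteq> s" "bounded_on_mu t F"
  shows "bounded_on_mu s (\<lambda>v. F (restrict v t))"
proof -
  note r = measurable_restrict_mu[OF assms(1,2)]
  obtain B where F: "F \<in> borel_measurable (mu t)" and B: "\<And>v. v \<in> space (mu t) \<Longrightarrow> \<bar>F v\<bar> \<le> B"
    using assms(3) by (auto simp: bounded_on_mu_def)
  have "\<bar>F (restrict v t)\<bar> \<le> B" if "v \<in> space (mu s)" for v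
    by (rule B[OF measurable_space[OF r that]])
  with measurable_compose[OF r F] show ?thesis by (auto simp: bounded_on_mu_def)
qed

lemma bounded_on_mu_mult:
  assumes "bounded_on_mu s F" "bounded_on_mu s G"
  shows "bounded_on_mu s (\<lambda>v. F v * G v)"
proof -
  obtain A B where *: "F \<in> borel_measurable (mu s)" "\<And>v. v \<in> space (mu s) \<Longrightarrow> \<bar>F v\<bar> \<le> A"
    "G \<in> borel_measurable (mu s)" "\<And>v. v \<in> space (mu s) \<Longrightarrow> \<bar>G v\<bar> \<le> B"
    using assms by (auto simp: bounded_on_mu_def)
  have "\<bar>F v * G v\<bar> \<le> A * B" if "v \<in> space (mu s)" for v
    unfolding abs_mult using *(2,4)[OF that] by (intro mult_mono) auto
  with * show ?thesis by (auto simp: bounded_on_mu_def)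
qed

lemma bounded_on_mu_indicator:
  assumes "finite s" "x \<in> unit_cube s"
  shows "bounded_on_mu s (indicator (box_oc s (\<lambda>_. 0) x))"
  using box_oc_sets_mu[OF assms] by (auto simp: bounded_on_mu_def indicator_def intro!: exI[of _ 1])

lemma spline_cong:
  assumes "finite s" "\<And>l. l \<in> s \<Longrightarrow> u l = u' l \<and> 0 \<le> u l \<and> x l = x' l \<and> x l \<le> 1"
  shows "spline j s u x = spline j s u' x'"
proof -
  have *: "u l = u' l" "x l = x' l" "0 \<le> u l" "x l \<le> 1" if "l \<in> s" for l
    using assms(2)[OF that] by auto
  have "spline j s u x = (\<Prod>l\<in>s. if u l \<le> x l then (x l - u l) ^ j / fact j else 0)"
    using assms(1) * by (intro spline_closed_form) auto
  also have "\<dots> = (\<Prod>l\<in>s. if u' l \<le> x' l then (x' l - u' l) ^ j / fact j else 0)"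
    using * by (intro prod.cong) auto
  also have "\<dots> = spline j s u' x'"
    using assms(1) *(3,4) by (intro spline_closed_form[symmetric]) (auto simp: *(1,2)[symmetric])
  finally show ?thesis .
qed

lemma bounded_on_mu_spline_right:
  assumes "finite s" shows "bounded_on_mu s (\<lambda>v. spline j s (\<lambda>_. 0) v)"
proof -
  note [measurable] = measurable_mu_component[OF measurable_ident assms, unfolded id_def]
  have "(\<lambda>v. \<Prod>l\<in>s. if 0 \<le> v l then (v l - 0) ^ j / fact j else 0) \<in> borel_measurable (mu s)"
    using assms by measurable
  also have "?this \<longleftrightarrow> (\<lambda>v. spline j s (\<lambda>_. 0) v) \<in> borel_measurable (mu s)"
    by (rule measurable_cong)
      (use assms in \<open>auto simp: space_mu_bounds less_imp_le spline_closed_form\<close>)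
  finally show ?thesis
    using spline_bounds[OF assms, of "\<lambda>_. 0" _ j] space_mu_bounds[OF assms]
    by (auto simp: bounded_on_mu_def intro!: exI[of _ 1])
qed

text \<open>In the coordinates outside \<open>t\<close> the integrand is constant, so j integrations
  there turn 1 into the product of the x(l)^j / j!, which is the spline with u = 0.\<close>

lemma primitive_restrict:
  assumes fin: "finite s" and ts: "t \<subseteq> s" and F: "bounded_on_mu t F" and "x \<in> unit_cube s"
  shows "primitive j s (\<lambda>v. F (restrict v t)) x = spline j (s - t) (\<lambda>_. 0) x * primitive j t F (restrict x t)"
  using assms(4)
proof (induction j arbitrary: x)
  case 0
  then show ?case by (auto simp: mem_unit_cube)
next
  case (Suc j)
  let ?r = "s - t"
  have ft: "finite t" and fr: "finite ?r" using fin ts by (auto intro: finite_subset)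
  have xt: "restrict x t \<in> unit_cube t" and xr: "restrict x ?r \<in> unit_cube ?r"
    using Suc.prems ts by (auto simp: mem_unit_cube)
  let ?f = "\<lambda>v. indicator (box_oc s (\<lambda>_. 0) x) v * (spline j ?r (\<lambda>_. 0) v * primitive j t F (restrict v t))"
  have meq: "mu s = Pi\<^sub>M (t \<union> ?r) (\<lambda>_. unit_lborel)"
    using ts mu_eq_PiM[OF fin] by (simp add: Un_absorb1)
  have spl: "bounded_on_mu s (\<lambda>v. spline j ?r (\<lambda>_. 0) v)"
  proof -
    have "spline j ?r (\<lambda>_. 0) v = spline j ?r (\<lambda>_. 0) (restrict v ?r)" if "v \<in> space (mu s)" for v
      by (rule spline_cong) (use fr that space_mu_bounds[OF fin] in auto)
    then show ?thesis
      using bounded_on_mu_restrict[OF fin _ bounded_on_mu_spline_right[OF fr], of j]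
      by (auto simp: bounded_on_mu_def cong: measurable_cong)
  qed
  have int: "integrable (mu s) ?f"
    by (intro bounded_on_mu_integrable[OF fin] bounded_on_mu_mult bounded_on_mu_indicator fin
        Suc.prems spl bounded_on_mu_restrict[OF fin ts] bounded_on_mu_primitive ft F)
  have "primitive (Suc j) s (\<lambda>v. F (restrict v t)) x =
      (LINT v:box_oc s (\<lambda>_. 0) x|mu s. spline j ?r (\<lambda>_. 0) v * primitive j t F (restrict v t))"
    unfolding primitive.simps by (rule set_integral_box_cong[OF Suc.prems Suc.IH])
  also have "\<dots> = (LINT v|mu s. ?f v)"
    unfolding set_lebesgue_integral_def by simp
  \<comment> \<open>The cube over \<open>s\<close> is split into the cubes over \<open>t\<close> and
    \<open>s - t\<close>; on merged points the integrand is a function of y times a function of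
    z.\<close>
  also have "\<dots> = (LINT y|mu t. LINT z|mu ?r. ?f (merge t ?r (y, z)))"
    unfolding meq mu_eq_PiM[OF ft] mu_eq_PiM[OF fr]
    by (rule unit_product.product_integral_fold) (use ft fr int meq in auto)
  also have "\<dots> = (LINT y|mu t. LINT z|mu ?r.
      (indicator (box_oc t (\<lambda>_. 0) (restrict x t)) y * primitive j t F y) *
      (indicator (box_oc ?r (\<lambda>_. 0) (restrict x ?r)) z * spline j ?r (\<lambda>_. 0) z))"
  proof (intro Bochner_Integration.integral_cong[OF refl])
    fix y z assume y: "y \<in> space (mu t)" and z: "z \<in> space (mu ?r)"
    let ?m = "merge t ?r (y, z)"
    have "restrict ?m t = y"
      using y ft by (auto simp: space_mu mem_box_oc restrict_def extensional_def fun_eq_iff)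
    moreover have "spline j ?r (\<lambda>_. 0) ?m = spline j ?r (\<lambda>_. 0) z"
      by (rule spline_cong) (use fr z space_mu_bounds[OF fr] in auto)
    moreover have "?m \<in> box_oc s (\<lambda>_. 0) x \<longleftrightarrow>
        y \<in> box_oc t (\<lambda>_. 0) (restrict x t) \<and> z \<in> box_oc ?r (\<lambda>_. 0) (restrict x ?r)"
    proof -
      have "?m \<in> extensional s" using ts by (auto simp: extensional_def merge_def)
      moreover have "(\<forall>l\<in>s. P l) \<longleftrightarrow> (\<forall>l\<in>t. P l) \<and> (\<forall>l\<in>?r. P l)" for P using ts by auto
      ultimately show ?thesis
        using y z ft fr by (simp add: mem_box_oc space_mu)
    qed
    ultimately show "?f ?m =
      (indicator (box_oc t (\<lambda>_. 0) (restrict x t)) y * primitive j t F y) *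
      (indicator (box_oc ?r (\<lambda>_. 0) (restrict x ?r)) z * spline j ?r (\<lambda>_. 0) z)"
      by (simp add: indicator_def)
  qed
  also have "\<dots> = primitive (Suc j) t F (restrict x t) *
      (LINT z:box_oc ?r (\<lambda>_. 0) (restrict x ?r)|mu ?r. spline j ?r (\<lambda>_. 0) z)"
    by (simp add: set_lebesgue_integral_def)
  also have "(LINT z:box_oc ?r (\<lambda>_. 0) (restrict x ?r)|mu ?r. spline j ?r (\<lambda>_. 0) z) =
      spline (Suc j) ?r (\<lambda>_. 0) (restrict x ?r)"
    by (rule integral_spline) (use fr xr in \<open>auto simp: mem_unit_cube\<close>)
  also have "\<dots> = spline (Suc j) ?r (\<lambda>_. 0) x"
    by (rule spline_cong) (use fr Suc.prems in \<open>auto simp: mem_unit_cube\<close>)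
  finally show ?case by (simp add: mult.commute del: spline.simps primitive.simps)
qed


section \<open>Generalized differences as iterated primitives\<close>

lemma gen_diff_cong:
  assumes "\<And>j. j \<in> s \<Longrightarrow> a j = a' j" "\<And>j. j \<in> s \<Longrightarrow> b j = b' j"
  shows "gen_diff s G a b = gen_diff s G a' b'"
proof -
  have "(\<lambda>j\<in>s. if j \<in> t then b j else a j) = (\<lambda>j\<in>s. if j \<in> t then b' j else a' j)" for t
    using assms by (intro restrict_ext) auto
  then show ?thesis by (simp add: gen_diff_def)
qed

text \<open>Let \<open>f r\<close> be the value of \<open>G\<close> at x with the coordinates
  outside \<open>r\<close> set to 0. Each generalized difference is the alternating sum of
  \<open>f\<close> over the subsets of \<open>t\<close>, and
  \<open>inclusion_exclusion_symmetric\<close> inverts this transform.\<close>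

lemma gen_diff_moebius:
  assumes fin: "finite s" and x: "x \<in> extensional s"
  shows "G x = (\<Sum>t\<in>Pow s. gen_diff t (\<lambda>y. G (\<lambda>j\<in>s. if j \<in> t then y j else 0)) (\<lambda>_. 0) (restrict x t))"
proof -
  define f where "f r = G (\<lambda>j\<in>s. if j \<in> r then x j else 0)" for r
  have "gen_diff t (\<lambda>y. G (\<lambda>j\<in>s. if j \<in> t then y j else 0)) (\<lambda>_. 0) (restrict x t) =
      (-1) ^ card t * (\<Sum>r\<in>Pow t. (-1) ^ card r * f r)" if t: "t \<in> Pow s" for t
  proof -
    have ft: "finite t" using t fin by (auto intro: finite_subset)
    \<comment> \<open>The exponents card (t - r) and card t + card r differ by 2 * card r, so the
      signs agree.\<close>
    have "(-1) ^ card (t - r) * G (\<lambda>j\<in>s. if j \<in> t then (\<lambda>j\<in>t. if j \<in> r then restrict x t j else 0) j else 0) =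
        (-1) ^ card t * ((-1) ^ card r * f r)" if r: "r \<in> Pow t" for r
    proof -
      have "(\<lambda>j\<in>s. if j \<in> t then (\<lambda>j\<in>t. if j \<in> r then restrict x t j else 0) j else 0) =
          (\<lambda>j\<in>s. if j \<in> r then x j else 0)"
        using r by (intro restrict_ext) auto
      moreover have "card t = card (t - r) + card r"
        using r ft card_Diff_subset[of r t] card_mono[of t r] by (auto dest: finite_subset)
      ultimately show ?thesis
        by (simp add: f_def power_add mult.assoc flip: power2_eq_square power_mult_distrib)
    qed
    then show ?thesis unfolding gen_diff_def sum_distrib_left by (intro sum.cong refl)
  qed
  moreover have "f s = (\<Sum>t\<in>Pow s. (-1) ^ card t * (\<Sum>r\<in>Pow t. (-1) ^ card r * f r))"
    by (rule inclusion_exclusion_symmetric) (simp_all add: fin)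
  moreover have "(\<lambda>j\<in>s. if j \<in> s then x j else 0) = x"
    using x by (auto simp: fun_eq_iff extensional_def)
  ultimately show ?thesis by (simp add: f_def)
qed

lemma generates_box:
  assumes "generates s G \<nu>" "y \<in> unit_cube s"
  shows "\<nu> (box_oc s (\<lambda>_. 0) y) = gen_diff s G (\<lambda>_. 0) y"
proof -
  have "restrict (\<lambda>_. 0) s \<in> unit_cube s" "\<forall>j\<in>s. restrict (\<lambda>_. 0) s j \<le> y j"
    using assms(2) by (auto simp: mem_unit_cube)
  then have "\<nu> (box_oc s (restrict (\<lambda>_. 0) s) y) = gen_diff s G (restrict (\<lambda>_. 0) s) y"
    using assms unfolding generates_def by blast
  also have "\<dots> = gen_diff s G (\<lambda>_. 0) y" by (rule gen_diff_cong) auto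
  finally show ?thesis by simp
qed

lemma spline_outside_box:
  assumes "finite s" "u \<in> space (mu s)" "u \<notin> box_oc s (\<lambda>_. 0) x" "\<forall>l\<in>s. x l \<le> 1"
  shows "spline j s u x = 0"
proof -
  have "\<forall>l\<in>s. 0 \<le> u l" using space_mu_bounds[OF assms(1,2)] by (simp add: less_imp_le)
  moreover obtain l where "l \<in> s" "\<not> u l \<le> x l"
    using assms(2,3) by (auto simp: space_mu assms(1) mem_box_oc)
  ultimately show ?thesis
    using assms(1,4) by (auto simp: spline_closed_form intro!: prod_zero)
qed

text \<open>The spline vanishes at points u that are not below x, so any domain containing (0,x]
  gives the same integral.\<close>

lemma set_integral_spline:
  assumes fin: "finite s" and N: "sets N = sets (mu s)" and x: "\<forall>l\<in>s. x l \<le> 1"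
    and B: "box_oc s (\<lambda>_. 0) x \<subseteq> B"
  shows "(LINT u:B|N. spline j s u x) = (LINT u|N. spline j s u x)"
  unfolding set_lebesgue_integral_def
proof (rule Bochner_Integration.integral_cong[OF refl])
  fix u assume "u \<in> space N"
  then have "u \<in> space (mu s)" using sets_eq_imp_space_eq[OF N] by simp
  then show "indicator B u *\<^sub>R spline j s u x = spline j s u x"
    using spline_outside_box[OF fin _ _ x, of u j] B by (auto simp: indicator_def)
qed

lemma integral_spline_0:
  assumes fin: "finite s" and N: "sets N = sets (mu s)" and x: "x \<in> unit_cube s"
  shows "(LINT u|N. spline 0 s u x) = measure N (box_oc s (\<lambda>_. 0) x)"
proof -
  let ?B = "box_oc s (\<lambda>_. 0) x"
  have sp: "space N = space (mu s)" using N by (rule sets_eq_imp_space_eq)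
  have "(LINT u|N. spline 0 s u x) = (LINT u|N. indicator ?B u)"
    by (rule Bochner_Integration.integral_cong[OF refl])
      (auto simp: sp space_mu fin mem_box_oc indicator_def)
  also have "\<dots> = measure N (?B \<inter> space N)" by simp
  also have "?B \<inter> space N = ?B"
    using box_oc_subset_unit[OF x] by (auto simp: sp space_mu fin)
  finally show ?thesis .
qed

section \<open>The measure generated by a function of bounded variation\<close>

context
  fixes s :: "nat set" and G :: "(nat \<Rightarrow> real) \<Rightarrow> real"
  assumes fin: "finite s" and bv: "variation_norm s G < \<infinity>"
begin

lemma generates_gen_measure_bv: "generates s G (gen_measure s G)"
proof -
  have "\<exists>\<nu>. generates s G \<nu>"
    by (rule ccontr) (use bv in \<open>simp add: variation_norm_def\<close>)
  then obtain \<nu> where "generates s G \<nu>" ..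
  then show ?thesis by (rule generates_gen_measure[OF fin])
qed

lemma signed_measure_gen_measure: "signed_measure (mu s) (gen_measure s G)"
  using generates_gen_measure_bv by (simp add: generates_def)

lemma total_variation_gen_measure: "total_variation (mu s) (gen_measure s G) < \<infinity>"
proof -
  have "\<exists>\<nu>. generates s G \<nu>" using generates_gen_measure_bv by blast
  then show ?thesis using bv unfolding variation_norm_def by simp
qed

text \<open>On the cube the order 0 spline is the indicator of (0,y], so this is the Jordan
  decomposition of the mass of that box, in the form that starts
  \<open>primitive_spline_integral\<close> at i = 0.\<close>

lemma gen_diff_eq_spline_integral:
  assumes y: "y \<in> unit_cube s"
  shows "gen_diff s G (\<lambda>_. 0) y =
    (LINT u|pos_variation (mu s) (gen_measure s G). spline 0 s u y) -
    (LINT u|neg_variation (mu s) (gen_measure s G). spline 0 s u y)"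
proof -
  have "gen_diff s G (\<lambda>_. 0) y = gen_measure s G (box_oc s (\<lambda>_. 0) y)"
    by (rule generates_box[OF generates_gen_measure_bv y, symmetric])
  also have "\<dots> = measure (pos_variation (mu s) (gen_measure s G)) (box_oc s (\<lambda>_. 0) y) -
      measure (neg_variation (mu s) (gen_measure s G)) (box_oc s (\<lambda>_. 0) y)"
    by (rule jordan_decomposition[OF signed_measure_gen_measure total_variation_gen_measure
          box_oc_sets_mu[OF fin y]])
  finally show ?thesis
    by (simp only: integral_spline_0[OF fin sets_variation(1) y] integral_spline_0[OF fin sets_variation(2) y])
qed

lemma bounded_on_mu_variation_integral:
  "bounded_on_mu s (\<lambda>v. LINT u|pos_variation (mu s) (gen_measure s G). spline j s u v)"
  "bounded_on_mu s (\<lambda>v. LINT u|neg_variation (mu s) (gen_measure s G). spline j s u v)"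
  by (intro bounded_on_mu_spline_integral fin sets_variation
      finite_measure_variation[OF total_variation_gen_measure])+

lemma bounded_on_mu_gen_diff: "bounded_on_mu s (gen_diff s G (\<lambda>_. 0))"
  by (rule bounded_on_mu_cong[OF bounded_on_mu_diff[OF bounded_on_mu_variation_integral]])
    (rule gen_diff_eq_spline_integral[OF space_mu_unit_cube[OF fin]])

text \<open>The domain \<open>B\<close> is left free so that (0,x] and (0,1] are both instances and
  the two integrals coincide through their common value.\<close>

lemma signed_integral_spline:
  assumes x: "x \<in> unit_cube s" and B: "box_oc s (\<lambda>_. 0) x \<subseteq> B"
  shows "signed_integral (mu s) (gen_measure s G) B (\<lambda>u. spline j s u x) =
    primitive j s (gen_diff s G (\<lambda>_. 0)) x"
proof -
  let ?p = "pos_variation (mu s) (gen_measure s G)" and ?n = "neg_variation (mu s) (gen_measure s G)"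
  have x1: "\<forall>l\<in>s. x l \<le> 1" using x by (simp add: mem_unit_cube)
  have "primitive j s (gen_diff s G (\<lambda>_. 0)) x =
      primitive j s (\<lambda>v. (LINT u|?p. spline 0 s u v) - (LINT u|?n. spline 0 s u v)) x"
    by (rule primitive_cong[OF gen_diff_eq_spline_integral x])
  also have "\<dots> = (LINT u|?p. spline (0 + j) s u x) - (LINT u|?n. spline (0 + j) s u x)"
    unfolding primitive_diff[OF fin bounded_on_mu_variation_integral x]
    by (intro arg_cong2[where f = "(-)"] primitive_spline_integral fin sets_variation x
        finite_measure_variation[OF total_variation_gen_measure])
  also have "\<dots> = signed_integral (mu s) (gen_measure s G) B (\<lambda>u. spline j s u x)"
    unfolding signed_integral_def
    by (simp only: set_integral_spline[OF fin sets_variation(1) x1 B]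
        set_integral_spline[OF fin sets_variation(2) x1 B] add_0)
  finally show ?thesis ..
qed

end

section \<open>Combinatorics of nested sequences\<close>

lemma last_chain_nth: "last (a # ss) = (a # ss) ! length ss"
  by (simp add: last_conv_nth)

lemma nested_seqs_0: "nested_seqs 0 d = {[]}"
  by (auto simp: nested_seqs_def)

lemma nested_seqs_subset:
  assumes "ss \<in> nested_seqs n d" shows "last ({1..d} # ss) \<subseteq> {1..d}"
  using assms by (cases ss rule: rev_cases) (auto simp: nested_seqs_def)

lemma finite_nested_seqs: "finite (nested_seqs n d)"
  by (rule finite_subset[OF _ finite_lists_length_eq[of "Pow {1..d}" n]])
    (auto simp: nested_seqs_def)

text \<open>Sequences grow at the end, by a subset of their smallest set; the prefix
  \<open>{1..d}\<close> supplies that set for the empty sequence.\<close>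

lemma nested_seqs_snoc:
  "ss @ [t] \<in> nested_seqs (Suc n) d \<longleftrightarrow> ss \<in> nested_seqs n d \<and> t \<subseteq> last ({1..d} # ss)"
proof (cases ss rule: rev_cases)
  case Nil
  then show ?thesis by (auto simp: nested_seqs_def)
next
  case (snoc ts a)
  show ?thesis
  proof
    assume "ss @ [t] \<in> nested_seqs (Suc n) d"
    then show "ss \<in> nested_seqs n d \<and> t \<subseteq> last ({1..d} # ss)"
      using snoc by (auto simp: nested_seqs_def sorted_wrt_append)
  next
    assume *: "ss \<in> nested_seqs n d \<and> t \<subseteq> last ({1..d} # ss)"
    then have "t \<subseteq> r" if "r \<in> set ss" for r
      using snoc that by (fastforce simp: nested_seqs_def sorted_wrt_append)
    moreover have "t \<subseteq> {1..d}" using * nested_seqs_subset by blast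
    ultimately show "ss @ [t] \<in> nested_seqs (Suc n) d"
      using * by (simp add: nested_seqs_def sorted_wrt_append)
  qed
qed

lemma sum_nested_seqs_Suc:
  "(\<Sum>ss\<in>nested_seqs (Suc n) d. f ss) =
    (\<Sum>ss\<in>nested_seqs n d. \<Sum>t\<in>Pow (last ({1..d} # ss)). f (ss @ [t]))"
proof -
  let ?S = "SIGMA ss:nested_seqs n d. Pow (last ({1..d} # ss))"
  have "nested_seqs (Suc n) d = (\<lambda>(ss, t). ss @ [t]) ` ?S"
  proof (intro equalityI subsetI)
    fix us assume us: "us \<in> nested_seqs (Suc n) d"
    then obtain ss t where "us = ss @ [t]"
      by (cases us rule: rev_cases) (auto simp: nested_seqs_def)
    then show "us \<in> (\<lambda>(ss, t). ss @ [t]) ` ?S"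
      using us by (auto simp: nested_seqs_snoc)
  qed (auto simp: nested_seqs_snoc)
  then have "(\<Sum>ss\<in>nested_seqs (Suc n) d. f ss) = (\<Sum>(ss, t)\<in>?S. f (ss @ [t]))"
    by (simp add: sum.reindex inj_on_def split_beta)
  also have "\<dots> = (\<Sum>ss\<in>nested_seqs n d. \<Sum>t\<in>Pow (last ({1..d} # ss)). f (ss @ [t]))"
    by (rule sum.Sigma[symmetric])
      (use finite_nested_seqs finite_subset[OF nested_seqs_subset] in auto)
  finally show ?thesis .
qed

lemma first_empty:
  assumes "ss ! m = {}" "m < length ss"
  shows "first_empty ss < length ss" "ss ! first_empty ss = {}"
  using LeastI[of "\<lambda>m. m < length ss \<and> ss ! m = {}" m] assms by (auto simp: first_empty_def)

lemma first_empty_snoc: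
  assumes "ss ! m = {}" "m < length ss"
  shows "first_empty (ss @ [t]) = first_empty ss"
  unfolding first_empty_def[of "ss @ [t]"]
proof (rule Least_equality)
  show "first_empty ss < length (ss @ [t]) \<and> (ss @ [t]) ! first_empty ss = {}"
    using first_empty[OF assms] by (simp add: nth_append)
  show "first_empty ss \<le> m'" if "m' < length (ss @ [t]) \<and> (ss @ [t]) ! m' = {}" for m'
  proof (cases "m' < length ss")
    case True
    then show ?thesis using that unfolding first_empty_def by (intro Least_le) (simp add: nth_append)
  qed (use first_empty[OF assms] in simp)
qed

text \<open>By nestedness an empty entry forces all later ones to be empty, so a nonempty last set
  excludes an earlier empty one.\<close>

lemma first_empty_snoc_empty:
  assumes "ss \<in> nested_seqs n d" "last ({1..d} # ss) \<noteq> {}"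
  shows "first_empty (ss @ [{}]) = length ss"
  unfolding first_empty_def
proof (rule Least_equality)
  show "length ss \<le> m" if m: "m < length (ss @ [{}]) \<and> (ss @ [{}]) ! m = {}" for m
  proof (rule ccontr)
    assume "\<not> length ss \<le> m"
    then have "m < length ss" "ss ! m = {}" using m by (auto simp: nth_append)
    moreover from this have "last ss \<subseteq> ss ! m"
    proof (cases "m = length ss - 1")
      case False
      with \<open>m < length ss\<close> have "ss ! (length ss - 1) \<subseteq> ss ! m"
        using assms(1) by (intro sorted_wrt_nth_less[of "(\<supseteq>)" ss]) (auto simp: nested_seqs_def)
      with \<open>m < length ss\<close> show ?thesis by (subst last_conv_nth) auto
    next
      case True
      moreover have "ss \<noteq> []" using \<open>m < length ss\<close> by auto
      ultimately show ?thesis by (simp add: last_conv_nth)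
    qed
    moreover have "ss \<noteq> []" using \<open>m < length ss\<close> by auto
    ultimately show False using assms(2) by simp
  qed
qed simp

text \<open>The factor \<open>j = 0\<close>, with \<open>s\<^sub>0 = {1..d}\<close>, equals 1 on the unit cube; including it makes the
  recursion along \<open>nested_seqs\<close> uniform.\<close>

definition chain_spline :: "nat \<Rightarrow> nat set list \<Rightarrow> (nat \<Rightarrow> real) \<Rightarrow> real" where
  "chain_spline d ss x = (\<Prod>j<length ss. spline j (({1..d} # ss) ! j - ss ! j) (\<lambda>_. 0) x)"

lemma chain_spline_snoc:
  "chain_spline d (ss @ [t]) x =
    chain_spline d ss x * spline (length ss) (last ({1..d} # ss) - t) (\<lambda>_. 0) x"
proof -
  have "({1..d} # ss @ [t]) ! j = ({1..d} # ss) ! j" if "j \<le> length ss" for j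
    using that nth_append[of "{1..d} # ss" "[t]" j] by simp
  then show ?thesis
    unfolding chain_spline_def last_chain_nth by (simp add: nth_append)
qed

lemma chain_spline_eq:
  assumes "x \<in> unit_cube {1..d}"
  shows "chain_spline d ss x = (\<Prod>j=1..length ss - 1. spline j (ss ! (j - 1) - ss ! j) (\<lambda>_. 0) x)"
proof (cases ss)
  case Nil
  then show ?thesis by (simp add: chain_spline_def)
next
  case (Cons a ts)
  have "spline 0 ({1..d} - a) (\<lambda>_. 0) x = 1" using assms by (auto simp: mem_unit_cube)
  then have "chain_spline d (a # ts) x =
      (\<Prod>j<length ts. spline (Suc j) ((a # ts) ! j - ts ! j) (\<lambda>_. 0) x)"
    unfolding chain_spline_def
    by (simp only: length_Cons prod.lessThan_Suc_shift nth_Cons_0 nth_Cons_Suc mult_1_left)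
  also have "\<dots> = (\<Prod>j=1..length ts. spline j ((a # ts) ! (j - 1) - (a # ts) ! j) (\<lambda>_. 0) x)"
    by (simp only: One_nat_def prod.atLeast1_atMost_eq diff_Suc_Suc diff_zero nth_Cons_Suc)
  finally show ?thesis by (simp add: Cons)
qed


section \<open>Expansion along nested sequences\<close>

text \<open>Over the empty index set the only box is a single point of mass 1, so integration does
  nothing. This evaluates the summand t = {}.\<close>

lemma primitive_const_empty: "primitive n {} (\<lambda>_. c) x = c"
proof (induction n arbitrary: x)
  case (Suc n)
  have "(LINT u:box_oc {} (\<lambda>_. 0) x|mu {}. c) = (LINT u|mu {}. c)"
    unfolding set_lebesgue_integral_def
    by (rule Bochner_Integration.integral_cong) (simp_all add: space_mu mem_box_oc)
  also have "\<dots> = c" by (simp add: measure_def emeasure_mu_space)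
  finally show ?case by (simp add: Suc)
qed simp

text \<open>For a branch stopping at this level m is the length of \<open>ss\<close>, so the product
  up to m already runs over all factors of the extended list.\<close>

lemma bar_spline_snoc_empty:
  assumes ss: "ss \<in> nested_seqs n d" "last ({1..d} # ss) \<noteq> {}" and x: "x \<in> unit_cube {1..d}"
  shows "bar_spline (ss @ [{}]) x = chain_spline d (ss @ [{}]) x"
    "deriv_at_zero d q (ss @ [{}]) = q ss (\<lambda>j\<in>last ({1..d} # ss). 0)"
  using ss by (simp_all add: bar_spline_def chain_spline_eq[OF x] first_empty_snoc_empty
      deriv_at_zero_def Let_def)

text \<open>Coefficient and constant of a stopped branch depend only on the entries up to
  \<open>first_empty\<close>, which padding does not touch.\<close>

lemma bar_spline_snoc_of_empty:
  assumes "last ({1..d} # ss) = {}" "ss \<noteq> []"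
  shows "bar_spline (ss @ [{}]) x = bar_spline ss x"
    "deriv_at_zero d q (ss @ [{}]) = deriv_at_zero d q ss"
proof -
  from assms have e: "ss ! (length ss - 1) = {}" "length ss - 1 < length ss"
    by (simp_all add: last_conv_nth)
  note fe = first_empty[OF e] first_empty_snoc[OF e, of "{}"]
  have "(ss @ [{}]) ! j = ss ! j" "(ss @ [{}]) ! (j - 1) = ss ! (j - 1)" if "j \<le> first_empty ss" for j
  proof -
    have "j < length ss" "j - 1 < length ss" using that fe(1) by linarith+
    then show "(ss @ [{}]) ! j = ss ! j" "(ss @ [{}]) ! (j - 1) = ss ! (j - 1)"
      by (simp_all add: nth_append)
  qed
  then have "(\<Prod>j=1..first_empty ss. spline j ((ss @ [{}]) ! (j - 1) - (ss @ [{}]) ! j) (\<lambda>_. 0) x) =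
      (\<Prod>j=1..first_empty ss. spline j (ss ! (j - 1) - ss ! j) (\<lambda>_. 0) x)"
    by (intro prod.cong) auto
  then show "bar_spline (ss @ [{}]) x = bar_spline ss x"
    using assms by (simp add: bar_spline_def fe(3))
  show "deriv_at_zero d q (ss @ [{}]) = deriv_at_zero d q ss"
    using fe by (simp add: deriv_at_zero_def Let_def)
qed

lemma deriv_section_snoc:
  "deriv_section d q (ss @ [t]) y = q ss (\<lambda>j\<in>last ({1..d} # ss). if j \<in> t then y j else 0)"
  by (simp add: deriv_section_def)

text \<open>The order n of the primitive equals the length of \<open>ss\<close>, so the spline over
  the discarded coordinates is precisely the factor that \<open>chain_spline\<close> gains when
  \<open>t\<close> is appended.\<close>

lemma chain_step:
  assumes ss: "ss \<in> nested_seqs n d" and ne: "last ({1..d} # ss) \<noteq> {}" and x: "x \<in> unit_cube {1..d}"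
    and bv: "\<And>t. t \<subseteq> last ({1..d} # ss) \<Longrightarrow> t \<noteq> {} \<Longrightarrow>
      variation_norm t (deriv_section d q (ss @ [t])) < \<infinity>"
  shows "chain_spline d ss x *
      primitive n (last ({1..d} # ss)) (q ss) (restrict x (last ({1..d} # ss))) =
    (\<Sum>t\<in>Pow (last ({1..d} # ss)). if t = {}
      then bar_spline (ss @ [t]) x * deriv_at_zero d q (ss @ [t])
      else chain_spline d (ss @ [t]) x *
        primitive n t (gen_diff t (deriv_section d q (ss @ [t])) (\<lambda>_. 0)) (restrict x t))"
proof -
  define s where "s = last ({1..d} # ss)"
  have sub: "s \<subseteq> {1..d}" unfolding s_def by (rule nested_seqs_subset[OF ss])
  then have fin: "finite s" by (rule finite_subset) simp
  have n: "length ss = n" using ss by (simp add: nested_seqs_def)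
  have xs: "restrict x s \<in> unit_cube s" using x sub by (auto simp: mem_unit_cube)
  let ?D = "\<lambda>t. gen_diff t (deriv_section d q (ss @ [t])) (\<lambda>_. 0)"
  \<comment> \<open>For t = {} the difference has a single term, the value at the origin; this case
    is settled directly since \<open>bv\<close> speaks of nonempty \<open>t\<close>.\<close>
  have D_empty: "?D {} = (\<lambda>_. q ss (\<lambda>j\<in>s. 0))"
    by (simp add: fun_eq_iff gen_diff_def deriv_section_snoc s_def)
  have bd: "bounded_on_mu t (?D t)" if "t \<subseteq> s" for t
  proof (cases "t = {}")
    case True
    then show ?thesis unfolding True D_empty by (auto simp: bounded_on_mu_def)
  next
    case False
    then show ?thesis
      using that bv fin by (intro bounded_on_mu_gen_diff) (auto simp: s_def intro: finite_subset)
  qed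
  have "primitive n s (q ss) (restrict x s) =
      primitive n s (\<lambda>v. \<Sum>t\<in>Pow s. ?D t (restrict v t)) (restrict x s)"
  proof (rule primitive_cong[OF _ xs])
    fix v assume "v \<in> unit_cube s"
    then have "v \<in> extensional s" by (simp add: mem_unit_cube)
    then show "q ss v = (\<Sum>t\<in>Pow s. ?D t (restrict v t))"
      using gen_diff_moebius[OF fin, of v "q ss"]
      by (simp add: deriv_section_snoc[abs_def] s_def)
  qed
  also have "\<dots> = (\<Sum>t\<in>Pow s. primitive n s (\<lambda>v. ?D t (restrict v t)) (restrict x s))"
    by (rule primitive_sum[OF fin _ xs]) (auto intro!: bounded_on_mu_restrict fin bd)
  also have "\<dots> = (\<Sum>t\<in>Pow s. spline n (s - t) (\<lambda>_. 0) x * primitive n t (?D t) (restrict x t))"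
  proof (rule sum.cong[OF refl])
    fix t assume "t \<in> Pow s"
    then have t: "t \<subseteq> s" by simp
    have "spline n (s - t) (\<lambda>_. 0) (restrict x s) = spline n (s - t) (\<lambda>_. 0) x"
      by (rule spline_cong) (use fin x sub in \<open>auto simp: mem_unit_cube\<close>)
    moreover have "restrict (restrict x s) t = restrict x t" using t by (simp add: Int_absorb1)
    ultimately show "primitive n s (\<lambda>v. ?D t (restrict v t)) (restrict x s) =
        spline n (s - t) (\<lambda>_. 0) x * primitive n t (?D t) (restrict x t)"
      using primitive_restrict[OF fin t bd[OF t] xs, of n] by simp
  qed
  finally have "chain_spline d ss x * primitive n s (q ss) (restrict x s) =
      (\<Sum>t\<in>Pow s. chain_spline d (ss @ [t]) x * primitive n t (?D t) (restrict x t))"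
    by (simp add: sum_distrib_left chain_spline_snoc n s_def mult.assoc)
  also have "\<dots> = (\<Sum>t\<in>Pow s. if t = {}
      then bar_spline (ss @ [t]) x * deriv_at_zero d q (ss @ [t])
      else chain_spline d (ss @ [t]) x * primitive n t (?D t) (restrict x t))"
  proof (rule sum.cong[OF refl])
    fix t
    have "primitive n {} (?D {}) (restrict x {}) = deriv_at_zero d q (ss @ [{}])"
      unfolding D_empty primitive_const_empty bar_spline_snoc_empty(2)[OF ss ne x] s_def ..
    then show "chain_spline d (ss @ [t]) x * primitive n t (?D t) (restrict x t) =
      (if t = {} then bar_spline (ss @ [t]) x * deriv_at_zero d q (ss @ [t])
      else chain_spline d (ss @ [t]) x * primitive n t (?D t) (restrict x t))"
      by (simp add: bar_spline_snoc_empty(1)[OF ss ne x])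
  qed
  finally show ?thesis by (simp add: s_def)
qed

context
  fixes d k :: nat and Q :: "(nat \<Rightarrow> real) \<Rightarrow> real"
    and q :: "nat set list \<Rightarrow> (nat \<Rightarrow> real) \<Rightarrow> real" and x :: "nat \<Rightarrow> real"
  assumes d: "d \<ge> 1" and q: "smooth_derivatives k d Q q" and x: "x \<in> unit_cube {1..d}"
begin

text \<open>Below level k finiteness is part of the existence of the next derivative; at level k it
  comes from the smoothness class.\<close>

lemma variation_norm_section:
  assumes "n \<le> k" "ss \<in> nested_seqs (Suc n) d" "last ss \<noteq> {}"
  shows "variation_norm (last ss) (deriv_section d q ss) < \<infinity>"
proof (cases "n < k")
  case True
  then show ?thesis
    using assms q by (auto simp: smooth_derivatives_def sequential_derivatives_def is_RN_derivative_def)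
next
  case False
  with assms(1) have "n = k" by simp
  then have "variation_norm (last ss) (top_deriv d q ss) < \<infinity>"
    using assms(2) q by (simp add: smooth_derivatives_def)
  then show ?thesis using assms(3) by (simp add: top_deriv_def)
qed

lemma last_nested_subset: "ss \<in> nested_seqs (Suc n) d \<Longrightarrow> last ss \<subseteq> {1..d}"
  using nested_seqs_subset[of ss "Suc n" d] by (cases "ss = []") (auto simp: nested_seqs_def)

lemma finite_last_nested: "ss \<in> nested_seqs (Suc n) d \<Longrightarrow> finite (last ss)"
  by (rule finite_subset[OF last_nested_subset finite_atLeastAtMost])

lemma gen_diff_section_eq_primitive:
  assumes "n < k" "ss \<in> nested_seqs (Suc n) d" "last ss \<noteq> {}" "y \<in> unit_cube (last ss)"
  shows "gen_diff (last ss) (deriv_section d q ss) (\<lambda>_. 0) y = primitive 1 (last ss) (q ss) y"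
proof -
  note fin = finite_last_nested[OF assms(2)]
  have bv: "variation_norm (last ss) (deriv_section d q ss) < \<infinity>"
    using assms by (intro variation_norm_section[of n]) auto
  have RN: "is_RN_derivative (last ss) (deriv_section d q ss) (q ss)"
    using assms q by (auto simp: smooth_derivatives_def sequential_derivatives_def)
  have "gen_diff (last ss) (deriv_section d q ss) (\<lambda>_. 0) y =
      gen_measure (last ss) (deriv_section d q ss) (box_oc (last ss) (\<lambda>_. 0) y)"
    by (rule generates_box[OF generates_gen_measure_bv[OF fin bv] assms(4), symmetric])
  also have "\<dots> = (LINT u:box_oc (last ss) (\<lambda>_. 0) y|mu (last ss). q ss u)"
    using RN box_oc_sets_mu[OF fin assms(4)] unfolding is_RN_derivative_def by blast
  finally show ?thesis by simp
qed

lemma restrict_unit_cube: "ss \<in> nested_seqs (Suc n) d \<Longrightarrow> restrict x (last ss) \<in> unit_cube (last ss)"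
  using last_nested_subset[of ss n] x by (auto simp: mem_unit_cube subset_iff)

text \<open>A branch ending in {} has {} as its only extension, so its term is carried over once;
  every other branch is expanded by \<open>chain_step\<close>.\<close>

lemma chain_step_sum:
  assumes n: "n \<le> k"
  shows "(\<Sum>ss\<in>nested_seqs n d. if last ({1..d} # ss) = {} then bar_spline ss x * deriv_at_zero d q ss
      else chain_spline d ss x * primitive n (last ({1..d} # ss)) (q ss) (restrict x (last ({1..d} # ss)))) =
    (\<Sum>ss\<in>nested_seqs (Suc n) d. if last ss = {} then bar_spline ss x * deriv_at_zero d q ss
      else chain_spline d ss x *
        primitive n (last ss) (gen_diff (last ss) (deriv_section d q ss) (\<lambda>_. 0)) (restrict x (last ss)))"
  unfolding sum_nested_seqs_Suc
proof (rule sum.cong[OF refl])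
  fix ss assume ss: "ss \<in> nested_seqs n d"
  show "(if last ({1..d} # ss) = {} then bar_spline ss x * deriv_at_zero d q ss
      else chain_spline d ss x * primitive n (last ({1..d} # ss)) (q ss) (restrict x (last ({1..d} # ss)))) =
    (\<Sum>t\<in>Pow (last ({1..d} # ss)). if last (ss @ [t]) = {}
      then bar_spline (ss @ [t]) x * deriv_at_zero d q (ss @ [t])
      else chain_spline d (ss @ [t]) x * primitive n (last (ss @ [t]))
        (gen_diff (last (ss @ [t])) (deriv_section d q (ss @ [t])) (\<lambda>_. 0)) (restrict x (last (ss @ [t]))))"
  proof (cases "last ({1..d} # ss) = {}")
    case True
    \<comment> \<open>Since d is at least 1, the initial set \<open>{1..d}\<close> is nonempty, so
      an empty last set comes from \<open>ss\<close> itself.\<close>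
    moreover from this have "ss \<noteq> []" using d by auto
    ultimately show ?thesis by (simp only: Pow_empty) (simp add: bar_spline_snoc_of_empty)
  next
    case False
    have bv: "variation_norm t (deriv_section d q (ss @ [t])) < \<infinity>"
      if "t \<subseteq> last ({1..d} # ss)" "t \<noteq> {}" for t
      using variation_norm_section[OF n, of "ss @ [t]"] ss that by (simp add: nested_seqs_snoc)
    show ?thesis
      unfolding if_not_P[OF False] last_snoc by (rule chain_step[OF ss False x]) (rule bv)
  qed
qed

text \<open>Each induction step lengthens the lists by Moebius inversion and then absorbs the
  resulting generalized difference as one more primitive of the next derivative.\<close>

lemma sequential_expansion:
  assumes "n \<le> k"
  shows "Q x = (\<Sum>ss\<in>nested_seqs n d.
    if last ({1..d} # ss) = {} then bar_spline ss x * deriv_at_zero d q ss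
    else chain_spline d ss x * primitive n (last ({1..d} # ss)) (q ss) (restrict x (last ({1..d} # ss))))"
  using assms
proof (induction n)
  case 0
  have "restrict x {1..d} = x" using x by (auto simp: mem_unit_cube extensional_restrict)
  moreover have "q [] = Q" using q by (simp add: smooth_derivatives_def sequential_derivatives_def)
  ultimately show ?case using d by (simp add: nested_seqs_0 chain_spline_def)
next
  case (Suc n)
  then have n: "n < k" by simp
  have "Q x = (\<Sum>ss\<in>nested_seqs (Suc n) d. if last ss = {} then bar_spline ss x * deriv_at_zero d q ss
      else chain_spline d ss x *
        primitive n (last ss) (gen_diff (last ss) (deriv_section d q ss) (\<lambda>_. 0)) (restrict x (last ss)))"
    using Suc n by (simp only: chain_step_sum less_imp_le)
  also have "\<dots> = (\<Sum>ss\<in>nested_seqs (Suc n) d.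
    if last ({1..d} # ss) = {} then bar_spline ss x * deriv_at_zero d q ss
    else chain_spline d ss x * primitive (Suc n) (last ({1..d} # ss)) (q ss) (restrict x (last ({1..d} # ss))))"
  proof (rule sum.cong[OF refl])
    fix ss assume ss: "ss \<in> nested_seqs (Suc n) d"
    then have l: "last ({1..d} # ss) = last ss" by (auto simp: nested_seqs_def)
    have "primitive n (last ss) (gen_diff (last ss) (deriv_section d q ss) (\<lambda>_. 0)) (restrict x (last ss)) =
        primitive (Suc n) (last ss) (q ss) (restrict x (last ss))" if ne: "last ss \<noteq> {}"
    proof -
      have "primitive n (last ss) (gen_diff (last ss) (deriv_section d q ss) (\<lambda>_. 0)) (restrict x (last ss)) =
          primitive n (last ss) (primitive 1 (last ss) (q ss)) (restrict x (last ss))"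
        by (rule primitive_cong[OF gen_diff_section_eq_primitive[OF n ss ne] restrict_unit_cube[OF ss]])
      then show ?thesis by (simp only: primitive_primitive plus_1_eq_Suc)
    qed
    then show "(if last ss = {} then bar_spline ss x * deriv_at_zero d q ss
      else chain_spline d ss x *
        primitive n (last ss) (gen_diff (last ss) (deriv_section d q ss) (\<lambda>_. 0)) (restrict x (last ss))) =
      (if last ({1..d} # ss) = {} then bar_spline ss x * deriv_at_zero d q ss
      else chain_spline d ss x * primitive (Suc n) (last ({1..d} # ss)) (q ss) (restrict x (last ({1..d} # ss))))"
      unfolding l by simp
  qed
  finally show ?case .
qed

text \<open>The last Moebius inversion is not followed by a derivative: the lists have length k + 1,
  but only k primitives act on the generalized difference.\<close>

lemma top_expansion:
  "Q x = (\<Sum>ss\<in>{ss \<in> nested_seqs (Suc k) d. last ss = {}}. bar_spline ss x * deriv_at_zero d q ss)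
    + (\<Sum>ss\<in>{ss \<in> nested_seqs (Suc k) d. last ss \<noteq> {}}. bar_spline ss x *
        primitive k (last ss) (gen_diff (last ss) (top_deriv d q ss) (\<lambda>_. 0)) (restrict x (last ss)))"
proof -
  have "Q x = (\<Sum>ss\<in>nested_seqs (Suc k) d. if last ss = {} then bar_spline ss x * deriv_at_zero d q ss
      else bar_spline ss x *
        primitive k (last ss) (gen_diff (last ss) (top_deriv d q ss) (\<lambda>_. 0)) (restrict x (last ss)))"
    unfolding sequential_expansion[OF order_refl] chain_step_sum[OF order_refl]
    by (rule sum.cong) (simp_all add: chain_spline_eq[OF x] bar_spline_def top_deriv_def)
  then show ?thesis
    by (simp add: sum.If_cases finite_nested_seqs Int_def conj_commute)
qed

lemma
  assumes ss: "ss \<in> nested_seqs (Suc k) d" and ne: "last ss \<noteq> {}"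
  shows signed_integral_top:
    "signed_integral (mu (last ss)) (gen_measure (last ss) (top_deriv d q ss))
        (box_oc (last ss) (\<lambda>_. 0) x) (\<lambda>u. spline k (last ss) u (restrict x (last ss))) =
      primitive k (last ss) (gen_diff (last ss) (top_deriv d q ss) (\<lambda>_. 0)) (restrict x (last ss))"
    and signed_integral_top_unit:
    "signed_integral (mu (last ss)) (gen_measure (last ss) (top_deriv d q ss))
        (box_oc (last ss) (\<lambda>_. 0) (\<lambda>_. 1)) (\<lambda>u. spline k (last ss) u (restrict x (last ss))) =
      primitive k (last ss) (gen_diff (last ss) (top_deriv d q ss) (\<lambda>_. 0)) (restrict x (last ss))"
    and primitive_top_cumulative:
    "primitive k (last ss) (top_cumulative d q ss) (restrict x (last ss)) =
      primitive k (last ss) (gen_diff (last ss) (top_deriv d q ss) (\<lambda>_. 0)) (restrict x (last ss))"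
proof -
  note fin = finite_last_nested[OF ss] and xs = restrict_unit_cube[OF ss]
  have bv: "variation_norm (last ss) (top_deriv d q ss) < \<infinity>"
    using ss q by (simp add: smooth_derivatives_def)
  show "signed_integral (mu (last ss)) (gen_measure (last ss) (top_deriv d q ss))
        (box_oc (last ss) (\<lambda>_. 0) x) (\<lambda>u. spline k (last ss) u (restrict x (last ss))) =
      primitive k (last ss) (gen_diff (last ss) (top_deriv d q ss) (\<lambda>_. 0)) (restrict x (last ss))"
    by (rule signed_integral_spline[OF fin bv xs]) simp
  show "signed_integral (mu (last ss)) (gen_measure (last ss) (top_deriv d q ss))
        (box_oc (last ss) (\<lambda>_. 0) (\<lambda>_. 1)) (\<lambda>u. spline k (last ss) u (restrict x (last ss))) =
      primitive k (last ss) (gen_diff (last ss) (top_deriv d q ss) (\<lambda>_. 0)) (restrict x (last ss))"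
    by (rule signed_integral_spline[OF fin bv xs box_oc_subset_unit[OF xs]])
  show "primitive k (last ss) (top_cumulative d q ss) (restrict x (last ss)) =
      primitive k (last ss) (gen_diff (last ss) (top_deriv d q ss) (\<lambda>_. 0)) (restrict x (last ss))"
  proof (rule primitive_cong[OF _ xs])
    fix y assume y: "y \<in> unit_cube (last ss)"
    have sub: "box_oc (last ss) (\<lambda>_. 0) y \<subseteq> space (mu (last ss))"
      using box_oc_subset_unit[OF y] by (simp add: space_mu fin)
    \<comment> \<open>Integrating 1 against the two variations gives the difference of their masses
      on the box, which is the signed mass by the Jordan decomposition.\<close>
    have "top_cumulative d q ss y = gen_measure (last ss) (top_deriv d q ss) (box_oc (last ss) (\<lambda>_. 0) y)"
      unfolding jordan_decomposition[OF signed_measure_gen_measure[OF fin bv]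
          total_variation_gen_measure[OF fin bv] box_oc_sets_mu[OF fin y]]
      using sub by (simp add: top_cumulative_def signed_integral_def set_lebesgue_integral_def Int_absorb2)
    then show "top_cumulative d q ss y = gen_diff (last ss) (top_deriv d q ss) (\<lambda>_. 0) y"
      using generates_box[OF generates_gen_measure_bv[OF fin bv] y] by simp
  qed
qed

end

text \<open>The expansion holds for every admissible choice \<open>q\<close> of versions. Its forms
  agree because both integrals and the primitive of the cumulative function equal the k-fold
  primitive of the generalized difference.\<close>

theorem theorem1:
  fixes d k :: nat
    and Q :: "(nat \<Rightarrow> real) \<Rightarrow> real"
    and q :: "nat set list \<Rightarrow> (nat \<Rightarrow> real) \<Rightarrow> real"
  assumes "d \<ge> 1" and "k \<ge> 1"
    and "Q \<in> smooth_class k d"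
    and "smooth_derivatives k d Q q"
  shows "\<forall>x\<in>unit_cube {1..d}.
    Q x = (\<Sum>ss\<in>{ss \<in> nested_seqs (Suc k) d. last ss = {}}.
              bar_spline ss x * deriv_at_zero d q ss)
        + (\<Sum>ss\<in>{ss \<in> nested_seqs (Suc k) d. last ss \<noteq> {}}.
              bar_spline ss x *
              signed_integral (mu (last ss)) (gen_measure (last ss) (top_deriv d q ss))
                (box_oc (last ss) (\<lambda>_. 0) x)
                (\<lambda>u. spline k (last ss) u (restrict x (last ss))))
  \<and> (\<forall>ss\<in>nested_seqs (Suc k) d. last ss \<noteq> {} \<longrightarrow>
        signed_integral (mu (last ss)) (gen_measure (last ss) (top_deriv d q ss))
          (box_oc (last ss) (\<lambda>_. 0) x)
          (\<lambda>u. spline k (last ss) u (restrict x (last ss)))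
      = signed_integral (mu (last ss)) (gen_measure (last ss) (top_deriv d q ss))
          (box_oc (last ss) (\<lambda>_. 0) (\<lambda>_. 1))
          (\<lambda>u. spline k (last ss) u (restrict x (last ss))))
  \<and> Q x = (\<Sum>ss\<in>{ss \<in> nested_seqs (Suc k) d. last ss = {}}.
              bar_spline ss x * deriv_at_zero d q ss)
        + (\<Sum>ss\<in>{ss \<in> nested_seqs (Suc k) d. last ss \<noteq> {}}.
              bar_spline ss x *
              primitive k (last ss) (top_cumulative d q ss) (restrict x (last ss)))"
  (is "\<forall>x\<in>_. Q x = ?empty x + ?integrals x \<and>
    (\<forall>ss\<in>_. _ \<longrightarrow> ?box x ss = ?unit x ss) \<and> _ = _ + ?primitives x")
proof
  fix x assume x: "x \<in> unit_cube {1..d}"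
  note parts = signed_integral_top[OF assms(1,4) x] signed_integral_top_unit[OF assms(1,4) x]
    primitive_top_cumulative[OF assms(1,4) x]
  have "Q x = ?empty x + ?integrals x"
    unfolding top_expansion[OF assms(1,4) x]
    by (intro arg_cong2[where f = "(+)"] sum.cong refl) (simp add: parts(1))
  moreover have "Q x = ?empty x + ?primitives x"
    unfolding top_expansion[OF assms(1,4) x]
    by (intro arg_cong2[where f = "(+)"] sum.cong refl) (simp add: parts(3))
  moreover have "\<forall>ss\<in>nested_seqs (Suc k) d. last ss \<noteq> {} \<longrightarrow> ?box x ss = ?unit x ss"
    using parts(1,2) by simp
  ultimately show "Q x = ?empty x + ?integrals x \<and>
    (\<forall>ss\<in>nested_seqs (Suc k) d. last ss \<noteq> {} \<longrightarrow> ?box x ss = ?unit x ss) \<and>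
    Q x = ?empty x + ?primitives x"
    by blast
qed

end
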